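(* Let $T=\mathbb{Z}_{p_1}*\cdots*\mathbb{Z}_{p_n}$ be a free product of $n\ge 2$ non-trivial cyclic groups ($p_i\in\{2,3,\dots\}\cup\{\infty\}$, $\mathbb{Z}_\infty=\mathbb{Z}$), not isomorphic to $\mathbb{Z}_2*\mathbb{Z}_2$. Then for every finite group $\Gamma$ there exist constants $A>1$, $B>0$ and $M\in\mathbb{N}$ such that for all integers $d\ge M$ the set $F(T,\Gamma,d)=\{H\le T \text{ free, of index}\le d,\ N_T(H)/H\cong\Gamma\}$, considered up to conjugacy in $T$, has cardinality at least $A^{Bd\log d}$.
   Context: $N_T(H)=\{g\in T: gHg^{-1}=H\}$ is the normaliser of $H$ in $T$. *)

theory Defs
  imports Complex_Main "HOL-Library.Extended_Nat" "HOL-Algebra.Elementary_Groups" "HOL-Algebra.Group_Action"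
begin

section \<open>Free products\<close>

text \<open>
  Words over the disjoint union of the factors \<open>G i\<close>, \<open>i \<in> I\<close>, modulo the congruence generated by
  deleting the neutral element of a factor and by multiplying neighbours from the same factor.
\<close>

definition fp_words :: "'i set \<Rightarrow> ('i \<Rightarrow> ('a, 'm) monoid_scheme) \<Rightarrow> ('i \<times> 'a) list set" where
  "fp_words I G = lists (SIGMA i:I. carrier (G i))"

inductive_set fp_rel ::
  "'i set \<Rightarrow> ('i \<Rightarrow> ('a, 'm) monoid_scheme) \<Rightarrow> (('i \<times> 'a) list \<times> ('i \<times> 'a) list) set"
  for I G where
  refl: "w \<in> fp_words I G \<Longrightarrow> (w, w) \<in> fp_rel I G"
| sym: "(v, w) \<in> fp_rel I G \<Longrightarrow> (w, v) \<in> fp_rel I G"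
| trans: "(u, v) \<in> fp_rel I G \<Longrightarrow> (v, w) \<in> fp_rel I G \<Longrightarrow> (u, w) \<in> fp_rel I G"
| one: "u \<in> fp_words I G \<Longrightarrow> v \<in> fp_words I G \<Longrightarrow> i \<in> I \<Longrightarrow>
    (u @ [(i, \<one>\<^bsub>G i\<^esub>)] @ v, u @ v) \<in> fp_rel I G"
| mult: "u \<in> fp_words I G \<Longrightarrow> v \<in> fp_words I G \<Longrightarrow> i \<in> I \<Longrightarrow>
    x \<in> carrier (G i) \<Longrightarrow> y \<in> carrier (G i) \<Longrightarrow>
    (u @ [(i, x), (i, y)] @ v, u @ [(i, x \<otimes>\<^bsub>G i\<^esub> y)] @ v) \<in> fp_rel I G"

definition free_product ::
  "'i set \<Rightarrow> ('i \<Rightarrow> ('a, 'm) monoid_scheme) \<Rightarrow> ('i \<times> 'a) list set monoid" where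
  "free_product I G =
    \<lparr>carrier = fp_words I G // fp_rel I G,
     monoid.mult = (\<lambda>U V. \<Union>x\<in>U. \<Union>y\<in>V. fp_rel I G `` {x @ y}),
     one = fp_rel I G `` {[]}\<rparr>"

lemma fp_words_append [simp]: "u @ v \<in> fp_words I G \<longleftrightarrow> u \<in> fp_words I G \<and> v \<in> fp_words I G"
  by (auto simp: fp_words_def)

lemma fp_words_Nil [simp]: "[] \<in> fp_words I G"
  by (simp add: fp_words_def)

lemma fp_words_Cons [simp]:
  "(i, x) # w \<in> fp_words I G \<longleftrightarrow> i \<in> I \<and> x \<in> carrier (G i) \<and> w \<in> fp_words I G"
  by (auto simp: fp_words_def)

lemma fp_rel_words:
  assumes "\<And>i. i \<in> I \<Longrightarrow> group (G i)" and "(v, w) \<in> fp_rel I G"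
  shows "v \<in> fp_words I G \<and> w \<in> fp_words I G"
  using assms(2)
  by (induction rule: fp_rel.induct)
    (auto simp: assms(1) group.is_monoid monoid.one_closed monoid.m_closed)

lemma equiv_fp_rel:
  assumes "\<And>i. i \<in> I \<Longrightarrow> group (G i)"
  shows "equiv (fp_words I G) (fp_rel I G)"
proof (rule equivI)
  show "fp_rel I G \<subseteq> fp_words I G \<times> fp_words I G" using fp_rel_words[of I G, OF assms] by (intro subrelI) simp
  show "refl_on (fp_words I G) (fp_rel I G)" by (auto simp: refl_on_def intro: fp_rel.refl)
  show "sym (fp_rel I G)" by (rule symI) (rule fp_rel.sym)
  show "trans (fp_rel I G)" by (rule transI) (rule fp_rel.trans)
qed

lemma fp_rel_append_left:
  assumes "(v, w) \<in> fp_rel I G" and "u \<in> fp_words I G"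
  shows "(u @ v, u @ w) \<in> fp_rel I G"
  using assms(1)
proof (induction rule: fp_rel.induct)
  case (one a b i)
  then show ?case using fp_rel.one[of "u @ a" I G b i] assms(2) by simp
next
  case (mult a b i x y)
  then show ?case using fp_rel.mult[of "u @ a" I G b i x y] assms(2) by simp
next
  case (refl w)
  then show ?case using assms(2) by (simp add: fp_rel.refl)
next
  case (sym v w)
  from sym.IH show ?case by (rule fp_rel.sym)
next
  case (trans a b c)
  from trans.IH show ?case by (rule fp_rel.trans)
qed

lemma fp_rel_append_right:
  assumes "(v, w) \<in> fp_rel I G" and "u \<in> fp_words I G"
  shows "(v @ u, w @ u) \<in> fp_rel I G"
  using assms(1)
proof (induction rule: fp_rel.induct)
  case (one a b i)
  then show ?case using fp_rel.one[of a I G "b @ u" i] assms(2) by simp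
next
  case (mult a b i x y)
  then show ?case using fp_rel.mult[of a I G "b @ u" i x y] assms(2) by simp
next
  case (refl w)
  then show ?case using assms(2) by (simp add: fp_rel.refl)
next
  case (sym v w)
  from sym.IH show ?case by (rule fp_rel.sym)
next
  case (trans a b c)
  from trans.IH show ?case by (rule fp_rel.trans)
qed

lemma fp_mult_classes:
  assumes "\<And>i. i \<in> I \<Longrightarrow> group (G i)" and "v \<in> fp_words I G" and "w \<in> fp_words I G"
  shows "fp_rel I G `` {v} \<otimes>\<^bsub>free_product I G\<^esub> fp_rel I G `` {w} = fp_rel I G `` {v @ w}"
proof -
  note E = equiv_fp_rel[of I G, OF assms(1)]
  have eq: "fp_rel I G `` {x @ y} = fp_rel I G `` {v @ w}"
    if "x \<in> fp_rel I G `` {v}" "y \<in> fp_rel I G `` {w}" for x y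
  proof -
    from that have vx: "(v, x) \<in> fp_rel I G" and wy: "(w, y) \<in> fp_rel I G" by simp_all
    have x: "x \<in> fp_words I G" using fp_rel_words[of I G, OF assms(1) vx] by simp
    have "(v @ w, x @ y) \<in> fp_rel I G"
      by (rule fp_rel.trans[OF fp_rel_append_right[OF vx assms(3)] fp_rel_append_left[OF wy x]])
    from equiv_class_eq[OF E this] show ?thesis by simp
  qed
  have "v \<in> fp_rel I G `` {v}" "w \<in> fp_rel I G `` {w}"
    using assms(2,3) by (simp_all add: fp_rel.refl)
  then have ne: "fp_rel I G `` {v} \<noteq> {}" "fp_rel I G `` {w} \<noteq> {}" by blast+
  have "(\<Union>x\<in>fp_rel I G `` {v}. \<Union>y\<in>fp_rel I G `` {w}. fp_rel I G `` {x @ y}) =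
      (\<Union>x\<in>fp_rel I G `` {v}. \<Union>y\<in>fp_rel I G `` {w}. fp_rel I G `` {v @ w})"
    by (intro SUP_cong HOL.refl eq)
  also have "\<dots> = fp_rel I G `` {v @ w}" by (simp only: UN_constant ne if_False)
  finally show ?thesis by (simp add: free_product_def)
qed

lemma group_free_product:
  assumes G: "\<And>i. i \<in> I \<Longrightarrow> group (G i)"
  shows "group (free_product I G)"
proof (rule groupI)
  note m = fp_mult_classes[of I G, OF G]
  let ?P = "free_product I G"
  have car: "carrier ?P = fp_words I G // fp_rel I G"
    and one: "\<one>\<^bsub>?P\<^esub> = fp_rel I G `` {[]}" by (simp_all add: free_product_def)
  show "\<one>\<^bsub>?P\<^esub> \<in> carrier ?P" by (simp add: car one quotientI)
  have rep: "\<exists>w\<in>fp_words I G. x = fp_rel I G `` {w}" if "x \<in> carrier ?P" for x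
    using that unfolding car quotient_def by blast
  show "x \<otimes>\<^bsub>?P\<^esub> y \<in> carrier ?P" if xy: "x \<in> carrier ?P" "y \<in> carrier ?P" for x y
  proof -
    obtain u v where "u \<in> fp_words I G" "x = fp_rel I G `` {u}"
      "v \<in> fp_words I G" "y = fp_rel I G `` {v}"
      using rep xy by metis
    then show ?thesis by (simp add: m car quotientI)
  qed
  show "x \<otimes>\<^bsub>?P\<^esub> y \<otimes>\<^bsub>?P\<^esub> z = x \<otimes>\<^bsub>?P\<^esub> (y \<otimes>\<^bsub>?P\<^esub> z)"
    if xyz: "x \<in> carrier ?P" "y \<in> carrier ?P" "z \<in> carrier ?P" for x y z
  proof -
    obtain u v w where "u \<in> fp_words I G" "x = fp_rel I G `` {u}"
      "v \<in> fp_words I G" "y = fp_rel I G `` {v}" "w \<in> fp_words I G" "z = fp_rel I G `` {w}"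
      using rep xyz by metis
    then show ?thesis by (simp add: m)
  qed
  show "\<one>\<^bsub>?P\<^esub> \<otimes>\<^bsub>?P\<^esub> x = x" if "x \<in> carrier ?P" for x
    using rep[OF that] by (auto simp: one m)
  have inv: "\<exists>v\<in>fp_words I G. (v @ w, []) \<in> fp_rel I G" if "w \<in> fp_words I G" for w
    using that
  proof (induction w)
    case Nil
    show ?case by (intro bexI[of _ "[]"]) (auto intro: fp_rel.refl)
  next
    case (Cons a w)
    obtain i x where a: "a = (i, x)" by force
    with Cons.prems have ix: "i \<in> I" "x \<in> carrier (G i)" "w \<in> fp_words I G" by auto
    obtain v where v: "v \<in> fp_words I G" "(v @ w, []) \<in> fp_rel I G" using Cons.IH ix by blast
    interpret Gi: group "G i" by (rule G[OF ix(1)])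
    let ?v = "v @ [(i, inv\<^bsub>G i\<^esub> x)]"
    have "(?v @ a # w, v @ [(i, \<one>\<^bsub>G i\<^esub>)] @ w) \<in> fp_rel I G"
      using fp_rel.mult[OF v(1) ix(3,1), of "inv\<^bsub>G i\<^esub> x" x] ix by (simp add: a)
    moreover have "(v @ [(i, \<one>\<^bsub>G i\<^esub>)] @ w, v @ w) \<in> fp_rel I G"
      by (rule fp_rel.one[OF v(1) ix(3,1)])
    ultimately have "(?v @ a # w, []) \<in> fp_rel I G"
      using v(2) by (blast intro: fp_rel.trans)
    moreover have "?v \<in> fp_words I G" using v ix by simp
    ultimately show ?case by blast
  qed
  show "\<exists>y\<in>carrier ?P. y \<otimes>\<^bsub>?P\<^esub> x = \<one>\<^bsub>?P\<^esub>" if "x \<in> carrier ?P" for x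
  proof -
    obtain w where w: "w \<in> fp_words I G" "x = fp_rel I G `` {w}"
      using rep[OF \<open>x \<in> carrier ?P\<close>] by blast
    obtain v where v: "v \<in> fp_words I G" "(v @ w, []) \<in> fp_rel I G" using inv w by blast
    have "fp_rel I G `` {v} \<otimes>\<^bsub>?P\<^esub> x = \<one>\<^bsub>?P\<^esub>"
      using equiv_class_eq[OF equiv_fp_rel[of I G, OF G] v(2)] by (simp add: w m v one)
    then show ?thesis using quotientI[OF v(1)] unfolding car by blast
  qed
qed

text \<open>The cyclic group of order \<open>p\<close>, where order \<open>\<infinity>\<close> gives the integers.\<close>

definition cyclic_group_of_order :: "enat \<Rightarrow> int monoid" where
  "cyclic_group_of_order p = (case p of enat m \<Rightarrow> integer_mod_group m | \<infinity> \<Rightarrow> integer_group)"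

section \<open>Free groups\<close>

text \<open>
  Words in letters \<open>s\<close> and their formal inverses; \<open>(s, True)\<close> stands for \<open>s\<close> and
  \<open>(s, False)\<close> for the inverse of \<open>s\<close>.
\<close>

definition reduced_word :: "('a \<times> bool) list \<Rightarrow> bool" where
  "reduced_word w = successively (\<lambda>(s, e) (t, f). \<not> (s = t \<and> e \<noteq> f)) w"

definition word_value :: "('a, 'm) monoid_scheme \<Rightarrow> ('a \<times> bool) list \<Rightarrow> 'a" where
  "word_value G w = foldr (\<lambda>(s, e) g. (if e then s else inv\<^bsub>G\<^esub> s) \<otimes>\<^bsub>G\<^esub> g) w \<one>\<^bsub>G\<^esub>"

definition free_basis :: "('a, 'm) monoid_scheme \<Rightarrow> 'a set \<Rightarrow> bool" where
  "free_basis G S \<longleftrightarrow> S \<subseteq> carrier G \<and>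
    (\<forall>g\<in>carrier G. \<exists>!w. w \<in> lists (S \<times> UNIV) \<and> reduced_word w \<and> word_value G w = g)"

definition free_group :: "('a, 'm) monoid_scheme \<Rightarrow> bool" where
  "free_group G \<longleftrightarrow> group G \<and> (\<exists>S. free_basis G S)"

section \<open>Free subgroups of bounded index with prescribed normaliser quotient\<close>

text \<open>Finiteness of the index is required explicitly, as \<open>card\<close> of an infinite set is \<open>0\<close>.\<close>

definition free_subgroups ::
  "('a, 'm) monoid_scheme \<Rightarrow> ('g, 'k) monoid_scheme \<Rightarrow> nat \<Rightarrow> 'a set set" where
  "free_subgroups T \<Gamma> d = {H. subgroup H T \<and> free_group (T\<lparr>carrier := H\<rparr>) \<and>
     finite (rcosets\<^bsub>T\<^esub> H) \<and> card (rcosets\<^bsub>T\<^esub> H) \<le> d \<and>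
     (T\<lparr>carrier := normalizer T H\<rparr>) Mod H \<cong> \<Gamma>}"

definition conjugacy_classes_of_subgroups ::
  "('a, 'm) monoid_scheme \<Rightarrow> 'a set set \<Rightarrow> 'a set set set" where
  "conjugacy_classes_of_subgroups T \<H> =
     orbits T \<H> (\<lambda>g H. g <#\<^bsub>T\<^esub> H #>\<^bsub>T\<^esub> inv\<^bsub>T\<^esub> g)"

text \<open>
  The library normaliser is a stabiliser under the conjugation action; on subsets of the carrier
  it is the set below.
\<close>

lemma normalizer_eq:
  assumes "H \<subseteq> carrier T"
  shows "normalizer T H = {g \<in> carrier T. g <#\<^bsub>T\<^esub> H #>\<^bsub>T\<^esub> inv\<^bsub>T\<^esub> g = H}"
  using assms by (simp add: normalizer_def stabilizer_def)

end

theory Submission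
  imports Defs "HOL-Combinatorics.Permutations"
begin

text \<open>
  A subgroup of index \<open>d\<close> is a point stabiliser of a transitive \<open>T\<close>-set with \<open>d\<close> points; it is free
  if every generator of a finite factor acts with all cycles of full length, and \<open>N_T(H)/H\<close> is the
  group of automorphisms of the \<open>T\<close>-set. So it suffices to construct \<open>M!\<close> pairwise non-isomorphic
  such \<open>T\<close>-sets with automorphism group \<open>\<Gamma>\<close> and with \<open>O(M)\<close> points.

  The points are \<open>((a, b, j), g)\<close> with a row \<open>a\<close>, a column \<open>b\<close> modulo the order \<open>q\<close> of the last
  generator, a copy \<open>j \<le> M\<close> and a sheet \<open>g \<in> \<Gamma>\<close>. All other generators act on the rows only, and the last
  generator is a conjugate \<open>\<phi> \<circ> shift \<circ> \<phi>\<inverse>\<close> of the column shift, so all cycle lengths are automatic. The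
  permutation \<open>\<phi>\<close> does three things. In row \<open>a0\<close> it links the copies cyclically, and in row \<open>a1\<close>
  it permutes the copies by an arbitrary permutation \<open>\<pi>\<close> while moving between the sheets. Row \<open>a2\<close>
  stays intact, which makes every copy connected. Finally a three-cycle creates exactly
  one place per sheet where the last generator agrees with the row rotation \<open>a0 \<mapsto> a1 \<mapsto> a2\<close>.
  Equivariant maps preserve these marked points, hence are determined by what they do on
  sheets, and they detect \<open>\<pi>\<close>.
\<close>

section \<open>The universal property of a free product of cyclic groups\<close>

abbreviation Perm :: "('x \<Rightarrow> 'x) monoid" where
  "Perm \<equiv> BijGroup UNIV"

lemma carrier_Perm: "f \<in> carrier Perm \<longleftrightarrow> bij f"
  by (simp add: BijGroup_def Bij_def)

lemma one_Perm: "\<one>\<^bsub>Perm\<^esub> = id"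
  by (auto simp: BijGroup_def)

lemma mult_Perm: "bij f \<Longrightarrow> bij g \<Longrightarrow> f \<otimes>\<^bsub>Perm\<^esub> g = f \<circ> g"
  by (auto simp: BijGroup_def Bij_def compose_def)

lemma pow_Perm: "bij f \<Longrightarrow> f [^]\<^bsub>Perm\<^esub> (m::nat) = f ^^ m"
proof (induction m)
  case (Suc m)
  have "bij (f ^^ m)" using Suc.prems by (induction m) (auto simp: bij_comp)
  with Suc show ?case by (simp add: mult_Perm funpow_Suc_right del: funpow.simps)
qed (simp add: one_Perm)

locale cyclic_free_product =
  fixes n :: nat and p :: "nat \<Rightarrow> enat" and T :: "(nat \<times> int) list set monoid" (structure)
  assumes two_le: "\<And>i. i < n \<Longrightarrow> 2 \<le> p i"
    and T_eq: "T = free_product {..<n} (\<lambda>i. cyclic_group_of_order (p i))"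
begin

abbreviation C :: "nat \<Rightarrow> int monoid" where
  "C i \<equiv> cyclic_group_of_order (p i)"

abbreviation cls :: "(nat \<times> int) list \<Rightarrow> (nat \<times> int) list set" where
  "cls w \<equiv> fp_rel {..<n} C `` {w}"

definition gen :: "nat \<Rightarrow> (nat \<times> int) list set" where
  "gen i = cls [(i, 1)]"

lemma group_C: "group (C i)"
  by (simp add: cyclic_group_of_order_def split: enat.split)

lemma group_T: "group T"
  unfolding T_eq by (rule group_free_product) (rule group_C)

sublocale group T by (rule group_T)

lemma one_C: "\<one>\<^bsub>C i\<^esub> = 0"
  by (simp add: cyclic_group_of_order_def split: enat.split)

lemma mult_C: "x \<otimes>\<^bsub>C i\<^esub> y = (case p i of enat m \<Rightarrow> (x + y) mod int m | \<infinity> \<Rightarrow> x + y)"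
  by (simp add: cyclic_group_of_order_def split: enat.split)

text \<open>The bound \<open>2 \<le> p i\<close> matters: \<open>integer_mod_group 0\<close> is the
  group of all integers, so the finite case has this form only for a nonzero modulus.\<close>

lemma carrier_C:
  assumes "i < n"
  shows "carrier (C i) = (case p i of enat m \<Rightarrow> {0..<int m} | \<infinity> \<Rightarrow> UNIV)"
  using two_le[OF assms]
  by (auto simp: cyclic_group_of_order_def carrier_integer_mod_group numeral_eq_enat split: enat.split)

lemma one_in_C: "i < n \<Longrightarrow> 1 \<in> carrier (C i)"
  using two_le[of i] by (auto simp: carrier_C numeral_eq_enat split: enat.split)

lemma carrier_T: "carrier T = cls ` fp_words {..<n} C"
  by (auto simp: T_eq free_product_def quotient_def)

lemma one_T: "\<one> = cls []"
  by (simp add: T_eq free_product_def)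

lemma cls_append:
  "u \<in> fp_words {..<n} C \<Longrightarrow> v \<in> fp_words {..<n} C \<Longrightarrow> cls (u @ v) = cls u \<otimes> cls v"
  unfolding T_eq by (rule fp_mult_classes[symmetric]) (rule group_C)

lemma cls_eqI: "(u, v) \<in> fp_rel {..<n} C \<Longrightarrow> cls u = cls v"
  by (rule equiv_class_eq[OF equiv_fp_rel]) (rule group_C)

lemma gen_closed [simp, intro]: "i < n \<Longrightarrow> gen i \<in> carrier T"
  by (auto simp: carrier_T gen_def one_in_C)

lemma cls_letter_mult:
  assumes "i < n" "x \<in> carrier (C i)" "y \<in> carrier (C i)"
  shows "cls [(i, x \<otimes>\<^bsub>C i\<^esub> y)] = cls [(i, x)] \<otimes> cls [(i, y)]"
proof -
  have "cls [(i, x), (i, y)] = cls [(i, x \<otimes>\<^bsub>C i\<^esub> y)]"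
    using fp_rel.mult[of "[]" "{..<n}" C "[]" i x y] assms by (intro cls_eqI) simp
  then show ?thesis using cls_append[of "[(i, x)]" "[(i, y)]"] assms by simp
qed

lemma cls_letter_one: "i < n \<Longrightarrow> cls [(i, 0)] = \<one>"
  using cls_eqI[OF fp_rel.one[of "[]" "{..<n}" C "[]" i]] by (simp add: one_C one_T)

lemma cls_letter_nat:
  assumes "i < n" "int m \<in> carrier (C i)"
  shows "cls [(i, int m)] = gen i [^] m"
  using assms(2)
proof (induction m)
  case 0
  then show ?case using assms(1) by (simp add: cls_letter_one)
next
  case (Suc m)
  have m: "int m \<in> carrier (C i)" using Suc.prems assms(1) by (auto simp: carrier_C split: enat.splits)
  have "int (Suc m) = int m \<otimes>\<^bsub>C i\<^esub> 1"
    using Suc.prems assms(1) by (auto simp: carrier_C mult_C split: enat.splits)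
  then show ?case
    using cls_letter_mult[OF assms(1) m one_in_C[OF assms(1)]] Suc.IH[OF m] by (simp add: gen_def)
qed

lemma gen_pow_order:
  assumes "i < n" "p i = enat m"
  shows "gen i [^] m = \<one>"
proof -
  have m: "m \<ge> 2" using two_le[OF assms(1)] assms(2) by (simp add: numeral_eq_enat)
  have "int (m - 1) \<in> carrier (C i)" unfolding carrier_C[OF assms(1)] using assms(2) m by auto
  \<comment> \<open>The relation comes from the wrap-around \<open>(m - 1) + 1 = 0\<close> modulo
    \<open>m\<close>, because the letter \<open>m\<close> itself is not in the carrier.\<close>
  moreover have "0 = int (m - 1) \<otimes>\<^bsub>C i\<^esub> 1" unfolding mult_C using assms(2) m by (auto simp: of_nat_diff)
  ultimately have "\<one> = gen i [^] (m - 1) \<otimes> gen i"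
    using cls_letter_mult[OF assms(1), of "int (m - 1)" 1] cls_letter_nat[OF assms(1), of "m - 1"]
      one_in_C[OF assms(1)] cls_letter_one[OF assms(1)] by (simp add: gen_def)
  then show ?thesis using m by (metis Suc_diff_1 nat_pow_Suc less_le_trans zero_less_numeral)
qed

lemma cls_letter:
  assumes "i < n" "x \<in> carrier (C i)"
  shows "cls [(i, x)] = gen i [^] x"
proof (cases "0 \<le> x")
  case True
  then obtain m where "x = int m" using nonneg_int_cases by blast
  with assms cls_letter_nat[OF assms(1), of m] show ?thesis by (simp add: int_pow_int)
next
  case False
  \<comment> \<open>Negative letters exist only in an infinite factor; there the letter
    \<open>- m\<close> is the inverse of the letter \<open>m\<close>.\<close>
  then have inf: "p i = \<infinity>" using assms by (auto simp: carrier_C split: enat.splits)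
  from False obtain m where x: "x = - int m" by (metis nle_le nonpos_int_cases)
  have car: "carrier (C i) = UNIV" unfolding carrier_C[OF assms(1)] using inf by simp
  have "x \<otimes>\<^bsub>C i\<^esub> int m = 0" unfolding mult_C using inf x by simp
  then have "cls [(i, x)] \<otimes> cls [(i, int m)] = \<one>"
    using cls_letter_mult[OF assms(1), of x "int m"] cls_letter_one[OF assms(1)] by (simp add: car)
  moreover have "cls [(i, x)] \<in> carrier T" using assms by (auto simp: carrier_T)
  ultimately show ?thesis
    using cls_letter_nat[OF assms(1), of m] assms(1)
    by (simp add: car x int_pow_neg_int inv_equality)
qed

lemma cls_Cons:
  assumes "(i, a) # w \<in> fp_words {..<n} C"
  shows "cls ((i, a) # w) = gen i [^] a \<otimes> cls w"
  using cls_append[of "[(i, a)]" w] assms by (simp add: cls_letter)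

text \<open>Every letter is an integer power of its generator, so words can be peeled off one
  generator or inverse generator at a time. This replaces induction over words in the arguments
  about actions.\<close>

lemma T_induct [consumes 1, case_names one gen inv_gen]:
  assumes "t \<in> carrier T"
    and one: "P \<one>"
    and gen: "\<And>i t. i < n \<Longrightarrow> t \<in> carrier T \<Longrightarrow> P t \<Longrightarrow> P (gen i \<otimes> t)"
    and inv_gen: "\<And>i t. i < n \<Longrightarrow> t \<in> carrier T \<Longrightarrow> P t \<Longrightarrow> P (inv (gen i) \<otimes> t)"
  shows "P t"
proof -
  have pow: "P (x [^] m \<otimes> t)" if "x \<in> carrier T" "t \<in> carrier T" "P t"
    "\<And>t. t \<in> carrier T \<Longrightarrow> P t \<Longrightarrow> P (x \<otimes> t)" for x t and m :: nat
  proof (induction m)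
    case (Suc m)
    have "x [^] Suc m \<otimes> t = x \<otimes> (x [^] m \<otimes> t)"
      unfolding nat_pow_Suc2[OF that(1)] using that by (simp add: m_assoc)
    then show ?case using that(1,2,4) Suc.IH by simp
  qed (use that in simp)
  obtain w where "w \<in> fp_words {..<n} C" "t = cls w" using assms(1) by (auto simp: carrier_T)
  then show ?thesis
  proof (induction w arbitrary: t)
    case Nil
    then show ?case using one by (simp add: one_T)
  next
    case (Cons l w)
    obtain i a where l: "l = (i, a)" by force
    with Cons have i: "i < n" "a \<in> carrier (C i)" and w: "w \<in> fp_words {..<n} C" by auto
    have cw: "cls w \<in> carrier T" and Pw: "P (cls w)" using w Cons.IH by (auto simp: carrier_T)
    have t: "t = gen i [^] a \<otimes> cls w" using Cons.prems l cls_Cons by simp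
    show ?case
    proof (cases "0 \<le> a")
      case True
      then obtain m where "a = int m" using nonneg_int_cases by blast
      then show ?thesis using t pow[OF gen_closed[OF i(1)] cw Pw gen[OF i(1)]] by (simp add: int_pow_int)
    next
      case False
      then obtain m where a: "a = - int m" by (metis nle_le nonpos_int_cases)
      have "inv (gen i) \<in> carrier T" using i by simp
      then show ?thesis using t pow[OF _ cw Pw inv_gen[OF i(1)]] i(1)
        by (simp add: a int_pow_neg_int nat_pow_inv)
    qed
  qed
qed

text \<open>Words are evaluated in \<open>K\<close> by a fold. Evaluation is constant on
  \<open>fp_rel\<close> classes; \<open>ord\<close> enters only where the multiplication of a finite
  factor reduces exponents.\<close>

lemma universal_property:
  assumes K: "group K" and k: "\<And>i. i < n \<Longrightarrow> k i \<in> carrier K"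
    and ord: "\<And>i m. i < n \<Longrightarrow> p i = enat m \<Longrightarrow> k i [^]\<^bsub>K\<^esub> m = \<one>\<^bsub>K\<^esub>"
  shows "\<exists>f\<in>hom T K. \<forall>i<n. f (gen i) = k i"
proof -
  interpret K: group K by (rule K)
  define val where "val = (\<lambda>w. foldr (\<lambda>(i, a) g. k i [^]\<^bsub>K\<^esub> (a::int) \<otimes>\<^bsub>K\<^esub> g) w \<one>\<^bsub>K\<^esub>)"
  have val_Nil: "val [] = \<one>\<^bsub>K\<^esub>" by (simp add: val_def)
  have val_Cons: "val ((i, a) # w) = k i [^]\<^bsub>K\<^esub> a \<otimes>\<^bsub>K\<^esub> val w" for i a w by (simp add: val_def)
  have val_closed: "val w \<in> carrier K" if "w \<in> fp_words {..<n} C" for w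
    using that
  proof (induction w)
    case (Cons l w)
    then show ?case by (cases l) (simp add: val_Cons k)
  qed (simp add: val_Nil)
  have val_append: "val (u @ v) = val u \<otimes>\<^bsub>K\<^esub> val v"
    if "u \<in> fp_words {..<n} C" "v \<in> fp_words {..<n} C" for u v
    using that(1)
  proof (induction u)
    case Nil
    then show ?case using val_closed[OF that(2)] by (simp add: val_Nil)
  next
    case (Cons l u)
    then show ?case using val_closed that(2) by (cases l) (simp add: val_Cons k K.m_assoc)
  qed
  have powmod: "k i [^]\<^bsub>K\<^esub> (a mod int m) = k i [^]\<^bsub>K\<^esub> a" if "i < n" "p i = enat m" for i a m
  proof -
    have "k i [^]\<^bsub>K\<^esub> (int m * (a div int m)) = (k i [^]\<^bsub>K\<^esub> int m) [^]\<^bsub>K\<^esub> (a div int m)"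
      using k[OF that(1)] by (simp add: K.int_pow_pow)
    also have "\<dots> = \<one>\<^bsub>K\<^esub>" using ord[OF that] by (simp add: int_pow_int)
    finally have "k i [^]\<^bsub>K\<^esub> (int m * (a div int m) + a mod int m) = k i [^]\<^bsub>K\<^esub> (a mod int m)"
      using k[OF that(1)] K.int_pow_mult[of "k i" "int m * (a div int m)" "a mod int m"]
      by (simp del: mult_div_mod_eq)
    then show ?thesis by simp
  qed
  have val_rel: "val u = val v" if "(u, v) \<in> fp_rel {..<n} C" for u v
    using that
  proof (induction rule: fp_rel.induct)
    case (one u v i)
    have "val ([(i, \<one>\<^bsub>C i\<^esub>)] @ v) = val v"
      using one val_closed by (simp add: val_Cons one_C)
    moreover have "[(i, \<one>\<^bsub>C i\<^esub>)] @ v \<in> fp_words {..<n} C"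
      using one group_C by (simp add: group.is_monoid monoid.one_closed)
    ultimately show ?case using one val_append by metis
  next
    case (mult u v i x y)
    have "k i [^]\<^bsub>K\<^esub> (x \<otimes>\<^bsub>C i\<^esub> y) = k i [^]\<^bsub>K\<^esub> x \<otimes>\<^bsub>K\<^esub> k i [^]\<^bsub>K\<^esub> y"
      using mult.hyps k powmod by (auto simp: mult_C K.int_pow_mult split: enat.split)
    then have "val ([(i, x), (i, y)] @ v) = val ([(i, x \<otimes>\<^bsub>C i\<^esub> y)] @ v)"
      using mult.hyps val_closed k by (simp add: val_Cons K.m_assoc)
    moreover have "[(i, x), (i, y)] @ v \<in> fp_words {..<n} C" "[(i, x \<otimes>\<^bsub>C i\<^esub> y)] @ v \<in> fp_words {..<n} C"
      using mult.hyps group_C[of i] by (simp_all add: group.is_monoid monoid.m_closed)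
    ultimately show ?case using mult.hyps val_append by metis
  qed auto
  define f where "f = (\<lambda>c. val (SOME w. w \<in> c))"
  have f_cls: "f (cls w) = val w" if "w \<in> fp_words {..<n} C" for w
  proof -
    have "w \<in> cls w" using that by (simp add: fp_rel.refl)
    then have "(SOME v. v \<in> cls w) \<in> cls w" by (rule someI)
    then show ?thesis using val_rel by (simp add: f_def)
  qed
  show ?thesis
  proof (intro bexI[of _ f] allI impI)
    show "f \<in> hom T K"
    proof (rule homI)
      show "f x \<in> carrier K" if "x \<in> carrier T" for x
        using that f_cls val_closed by (auto simp: carrier_T)
      show "f (x \<otimes> y) = f x \<otimes>\<^bsub>K\<^esub> f y" if xy: "x \<in> carrier T" "y \<in> carrier T" for x y
      proof -
        obtain u v where "u \<in> fp_words {..<n} C" "x = cls u" "v \<in> fp_words {..<n} C" "y = cls v"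
          using xy by (auto simp: carrier_T)
        then show ?thesis using f_cls val_append by (simp add: cls_append[symmetric])
      qed
    qed
    show "f (gen i) = k i" if "i < n" for i
      using f_cls[of "[(i, 1)]"] that k[OF that] one_in_C[OF that] by (simp add: gen_def val_Cons val_Nil)
  qed
qed

end

section \<open>Actions by permutations\<close>

locale perm_action = cyclic_free_product +
  fixes k :: "nat \<Rightarrow> 'x \<Rightarrow> 'x"
  assumes bij_k: "\<And>i. i < n \<Longrightarrow> bij (k i)"
    and k_order: "\<And>i m. i < n \<Longrightarrow> p i = enat m \<Longrightarrow> k i ^^ m = id"
begin

definition act :: "(nat \<times> int) list set \<Rightarrow> 'x \<Rightarrow> 'x" where
  "act = (SOME f. f \<in> hom T Perm \<and> (\<forall>i<n. f (gen i) = k i))"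

lemma act: "act \<in> hom T Perm \<and> (\<forall>i<n. act (gen i) = k i)"
proof -
  have k: "\<And>i. i < n \<Longrightarrow> k i \<in> carrier Perm"
    using bij_k by (simp add: carrier_Perm)
  have ord: "\<And>i m. i < n \<Longrightarrow> p i = enat m \<Longrightarrow> k i [^]\<^bsub>Perm\<^esub> m = \<one>\<^bsub>Perm\<^esub>"
    by (simp add: pow_Perm bij_k one_Perm k_order)
  have "\<exists>f\<in>hom T (Perm :: ('x \<Rightarrow> 'x) monoid). \<forall>i<n. f (gen i) = k i"
    by (rule universal_property[OF group_BijGroup k ord])
  then have "\<exists>f. f \<in> hom T (Perm :: ('x \<Rightarrow> 'x) monoid) \<and> (\<forall>i<n. f (gen i) = k i)" by blast
  then show ?thesis unfolding act_def by (rule someI_ex)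
qed

lemma act_gen: "i < n \<Longrightarrow> act (gen i) = k i"
  using act by blast

lemma bij_act: "t \<in> carrier T \<Longrightarrow> bij (act t)"
  using act by (auto simp: hom_def carrier_Perm[symmetric])

lemma act_mult: "s \<in> carrier T \<Longrightarrow> t \<in> carrier T \<Longrightarrow> act (s \<otimes> t) x = act s (act t x)"
  using act by (simp add: hom_mult[of act T Perm] mult_Perm bij_act)

lemma act_one [simp]: "act \<one> x = x"
proof -
  have "act \<one> (act \<one> x) = act \<one> x" using act_mult[of \<one> \<one> x] by simp
  then show ?thesis using bij_act[of \<one>] by (auto simp: bij_def inj_eq)
qed

lemma act_inv_left [simp]: "t \<in> carrier T \<Longrightarrow> act (inv t) (act t x) = x"
  using act_mult[of "inv t" t x] by simp

lemma act_inv_right [simp]: "t \<in> carrier T \<Longrightarrow> act t (act (inv t) x) = x"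
  using act_mult[of t "inv t" x] by simp

lemma act_inv_eq_iff: "t \<in> carrier T \<Longrightarrow> act (inv t) x = y \<longleftrightarrow> x = act t y"
  by auto

lemma act_gen_pow: "i < n \<Longrightarrow> act (gen i [^] (m::nat)) x = (k i ^^ m) x"
proof (induction m arbitrary: x)
  case (Suc m)
  then show ?case by (simp add: act_mult act_gen funpow_swap1)
qed simp

lemma act_in:
  assumes "\<And>i. i < n \<Longrightarrow> k i ` X = X" "t \<in> carrier T" "x \<in> X"
  shows "act t x \<in> X"
  using assms(2,3)
proof (induction t arbitrary: x rule: T_induct)
  case one
  then show ?case by simp
next
  case (gen i t)
  then have "k i (act t x) \<in> k i ` X" by blast
  with gen assms(1) show ?case by (simp add: act_mult act_gen)
next
  case (inv_gen i t)
  \<comment> \<open>The preimage exists because \<open>k i\<close> maps \<open>X\<close> onto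
    \<open>X\<close>.\<close>
  then have "act t x \<in> k i ` X" using assms(1) by blast
  then obtain y where y: "y \<in> X" "act t x = act (gen i) y" using inv_gen by (auto simp: act_gen)
  with inv_gen show ?case by (simp add: act_mult)
qed

definition stab :: "'x \<Rightarrow> (nat \<times> int) list set set" where
  "stab x = {t \<in> carrier T. act t x = x}"

lemma subgroup_stab: "subgroup (stab x) T"
  by (rule subgroupI) (auto simp: stab_def act_mult act_inv_eq_iff)

lemma stab_act:
  assumes "g \<in> carrier T"
  shows "stab (act g x) = g <# stab x #> inv g"
proof -
  have "t \<in> stab (act g x) \<longleftrightarrow> t \<in> g <# stab x #> inv g" for t
  proof
    assume t: "t \<in> stab (act g x)"
    then have tc: "t \<in> carrier T" "act t (act g x) = act g x" by (auto simp: stab_def)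
    let ?h = "inv g \<otimes> t \<otimes> g"
    have "?h \<in> stab x" using tc assms by (simp add: stab_def act_mult)
    moreover have "g \<otimes> (inv g \<otimes> u) = u" if "u \<in> carrier T" for u
      using that assms by (simp add: m_assoc[symmetric])
    then have "t = g \<otimes> ?h \<otimes> inv g" using tc assms by (simp add: m_assoc inv_solve_left)
    ultimately show "t \<in> g <# stab x #> inv g" by (auto simp: l_coset_def r_coset_def)
  next
    assume "t \<in> g <# stab x #> inv g"
    then obtain h where "h \<in> stab x" "t = g \<otimes> h \<otimes> inv g" by (auto simp: l_coset_def r_coset_def)
    then show "t \<in> stab (act g x)" using assms by (simp add: stab_def act_mult)
  qed
  then show ?thesis by blast
qed

end

section \<open>Labelled walks and spanning trees\<close>

text \<open>The last argument is the product of the labels along a walk in \<open>F\<close> from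
  \<open>x0\<close>, later labels on the left. Being inductive, the predicate lets any action be
  followed along the tree, both the given one and its lift.\<close>

inductive tree_path ::
  "('a, 'm) monoid_scheme \<Rightarrow> ('e \<Rightarrow> 'x) \<Rightarrow> ('e \<Rightarrow> 'x) \<Rightarrow> ('e \<Rightarrow> 'a) \<Rightarrow> 'e set \<Rightarrow> 'x \<Rightarrow> 'x \<Rightarrow> 'a \<Rightarrow> bool"
  for G src tgt g F x0 where
  root: "tree_path G src tgt g F x0 x0 \<one>\<^bsub>G\<^esub>"
| forward: "e \<in> F \<Longrightarrow> tree_path G src tgt g F x0 (src e) t \<Longrightarrow>
    tree_path G src tgt g F x0 (tgt e) (g e \<otimes>\<^bsub>G\<^esub> t)"
| backward: "e \<in> F \<Longrightarrow> tree_path G src tgt g F x0 (tgt e) t \<Longrightarrow>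
    tree_path G src tgt g F x0 (src e) (inv\<^bsub>G\<^esub> (g e) \<otimes>\<^bsub>G\<^esub> t)"

lemma tree_path_mono:
  assumes "tree_path G src tgt g F x0 x t" "F \<subseteq> F'"
  shows "tree_path G src tgt g F' x0 x t"
  using assms(1) by induction (use assms(2) in \<open>auto intro: tree_path.intros\<close>)

lemma (in group) tree_path_closed:
  assumes "tree_path G src tgt g F x0 x t" "\<And>e. e \<in> F \<Longrightarrow> g e \<in> carrier G"
  shows "t \<in> carrier G"
  using assms(1) by induction (use assms(2) in auto)

text \<open>A tree on a vertex set of maximal size is taken. By \<open>conn\<close>, an edge crosses
  the boundary of every proper vertex set containing the root, so a smaller tree could still be
  enlarged.\<close>

lemma (in group) spanning_tree:
  fixes src tgt :: "'e \<Rightarrow> 'x"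
  assumes X: "finite X" "x0 \<in> X"
    and E: "\<And>e. e \<in> E \<Longrightarrow> src e \<in> X \<and> tgt e \<in> X \<and> g e \<in> carrier G"
    and conn: "\<And>V. x0 \<in> V \<Longrightarrow> V \<subset> X \<Longrightarrow> \<exists>e\<in>E. (src e \<in> V) \<noteq> (tgt e \<in> V)"
  obtains F t where "F \<subseteq> E" "\<And>e. e \<in> F \<Longrightarrow> g e \<otimes> t (src e) = t (tgt e)" "t x0 = \<one>"
    "\<And>x. x \<in> X \<Longrightarrow> tree_path G src tgt g F x0 x (t x)"
proof -
  define P where "P = (\<lambda>V F t. x0 \<in> V \<and> V \<subseteq> X \<and> F \<subseteq> E \<and> t x0 = \<one> \<and>
    (\<forall>e\<in>F. src e \<in> V \<and> tgt e \<in> V \<and> g e \<otimes> t (src e) = t (tgt e)) \<and>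
    (\<forall>x\<in>V. tree_path G src tgt g F x0 x (t x)))"
  have start: "\<exists>F t. P {x0} F t"
    by (rule exI[of _ "{}"], rule exI[of _ "\<lambda>_. \<one>"]) (use X in \<open>auto simp: P_def intro: tree_path.root\<close>)
  have bound: "\<forall>V. (\<exists>F t. P V F t) \<longrightarrow> card V < Suc (card X)"
    using X by (auto simp: P_def card_mono less_Suc_eq_le)
  have "\<exists>V. (\<exists>F t. P V F t) \<and> (\<forall>V'. (\<exists>F t. P V' F t) \<longrightarrow> card V' \<le> card V)"
    by (rule ex_has_greatest_nat[of "\<lambda>V. \<exists>F t. P V F t", OF start bound])
  then obtain V where V: "\<exists>F t. P V F t" and max: "\<And>V'. \<exists>F t. P V' F t \<Longrightarrow> card V' \<le> card V"
    by blast
  from V obtain F t where P: "P V F t" by blast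
  then have V: "x0 \<in> V" "V \<subseteq> X" and F: "F \<subseteq> E" and t0: "t x0 = \<one>"
    and ends: "\<And>e. e \<in> F \<Longrightarrow> src e \<in> V \<and> tgt e \<in> V"
    and edge: "\<And>e. e \<in> F \<Longrightarrow> g e \<otimes> t (src e) = t (tgt e)"
    and path: "\<And>x. x \<in> V \<Longrightarrow> tree_path G src tgt g F x0 x (t x)"
    by (auto simp: P_def)
  have tc: "t x \<in> carrier G" if "x \<in> V" for x
    using tree_path_closed[OF path[OF that]] F E by blast
  have fin: "finite V" using V X finite_subset by blast
  have "V = X"
  proof (rule ccontr)
    assume "V \<noteq> X"
    then obtain e where e: "e \<in> E" "(src e \<in> V) \<noteq> (tgt e \<in> V)" using conn[of V] V by blast
    have new: "\<exists>F t. P (insert y V) F t" if "y \<notin> V" "y = src e \<and> tgt e \<in> V \<or> y = tgt e \<and> src e \<in> V" for y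
    proof -
      \<comment> \<open>The label of the new vertex is forced by
        \<open>g e \<otimes> t (src e) = t (tgt e)\<close>, read in the direction in which the edge
        is crossed.\<close>
      define a where "a = (if y = tgt e then g e \<otimes> t (src e) else inv (g e) \<otimes> t (tgt e))"
      have yx: "y \<noteq> x0" using that V by auto
      have 1: "tree_path G src tgt g (insert e F) x0 x ((t(y := a)) x)" if "x \<in> V" for x
        using tree_path_mono[OF path[OF that], of "insert e F"] that \<open>y \<notin> V\<close> by auto
      have 2: "tree_path G src tgt g (insert e F) x0 y ((t(y := a)) y)"
        using that(2)
      proof
        assume h: "y = src e \<and> tgt e \<in> V"
        then have "y \<noteq> tgt e" using that by auto
        then show ?thesis using tree_path.backward[of e "insert e F" G src tgt g x0] 1[of "tgt e"] h
          by (auto simp: a_def)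
      next
        assume h: "y = tgt e \<and> src e \<in> V"
        then have "y \<noteq> src e" using that by auto
        then show ?thesis using tree_path.forward[of e "insert e F" G src tgt g x0] 1[of "src e"] h
          by (auto simp: a_def)
      qed
      have 3: "g f \<otimes> (t(y := a)) (src f) = (t(y := a)) (tgt f)" if "f \<in> insert e F" for f
      proof (cases "f = e")
        case True
        show ?thesis using \<open>y = src e \<and> tgt e \<in> V \<or> y = tgt e \<and> src e \<in> V\<close> \<open>y \<notin> V\<close>
          True e E[of e] tc by (auto simp: a_def m_assoc[symmetric])
      next
        case False
        then show ?thesis using that edge[of f] ends[of f] \<open>y \<notin> V\<close> by auto
      qed
      have "P (insert y V) (insert e F) (t(y := a))"
        unfolding P_def using 1 2 3 V F t0 ends that e E[of e] yx by auto
      then show ?thesis by blast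
    qed
    show False
    proof (cases "src e \<in> V")
      case True
      then show ?thesis using new[of "tgt e"] max[of "insert (tgt e) V"] e fin by auto
    next
      case False
      then show ?thesis using new[of "src e"] max[of "insert (src e) V"] e fin by auto
    qed
  qed
  then show thesis using that[OF F edge t0 path] by blast
qed

section \<open>Stabilisers of semiregular actions are free\<close>

lemma funpow_mult_id: "f ^^ m = id \<Longrightarrow> f ^^ (m * j) = id"
  by (simp add: funpow_mult[symmetric])

text \<open>\<open>b\<close> picks a base point on every cycle and \<open>r\<close> counts the steps
  from it. This turns a cycle into a star with centre \<open>b x\<close>.\<close>

lemma cyclic_orbit_base:
  fixes f :: "'x \<Rightarrow> 'x"
  assumes id: "f ^^ m = id" and m: "0 < m" and X: "f ` X = X"
    and free: "\<And>x j. x \<in> X \<Longrightarrow> 0 < j \<Longrightarrow> j < m \<Longrightarrow> (f ^^ j) x \<noteq> x"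
  shows "\<exists>b r. \<forall>x\<in>X. b x \<in> X \<and> (f ^^ r x) (b x) = x \<and> b (f x) = b x \<and>
    r (f x) = Suc (r x) mod m \<and> b (b x) = b x \<and> r (b x) = (0::nat)"
proof -
  define orb where "orb = (\<lambda>x. range (\<lambda>j. (f ^^ j) x))"
  have orb_eq: "orb ((f ^^ j) x) = orb x" for j x
  proof -
    have "\<exists>l. (f ^^ i) x = (f ^^ l) ((f ^^ j) x)" for i
    proof -
      \<comment> \<open>Going back \<open>j\<close> steps amounts to \<open>m * j - j\<close> steps
        forward.\<close>
      have "j \<le> m * j" using m by simp
      then have shift: "i + (m * j - j) + j = i + m * j" by linarith
      have "(f ^^ (i + (m * j - j))) ((f ^^ j) x) = (f ^^ (i + (m * j - j) + j)) x"
        by (simp only: funpow_add o_apply)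
      also have "\<dots> = (f ^^ i) x" unfolding shift using id by (simp add: funpow_add funpow_mult_id)
      finally show ?thesis by (intro exI) (rule HOL.sym)
    qed
    moreover have "(f ^^ i) ((f ^^ j) x) = (f ^^ (i + j)) x" for i by (simp add: funpow_add)
    ultimately show ?thesis unfolding orb_def by (fastforce simp: image_iff)
  qed
  \<comment> \<open>The choice depends on the orbit as a set alone, so it is constant on
    cycles.\<close>
  define b where "b = (\<lambda>x. SOME y. y \<in> orb x)"
  have self: "x \<in> orb x" for x
    unfolding orb_def by (rule range_eqI[of _ _ 0]) simp
  then have b_orb: "b x \<in> orb x" for x
    unfolding b_def by (rule someI[of "\<lambda>y. y \<in> orb x"])
  have orb_b: "orb (b x) = orb x" for x
  proof -
    obtain j where "b x = (f ^^ j) x" using b_orb[of x] by (auto simp: orb_def)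
    then show ?thesis by (simp add: orb_eq)
  qed
  have fX: "(f ^^ j) x \<in> X" if "x \<in> X" for j x
    using that X by (induction j) auto
  have bX: "b x \<in> X" if "x \<in> X" for x
    using b_orb[of x] fX[OF that] by (auto simp: orb_def)
  have mod: "(f ^^ (j mod m)) x = (f ^^ j) x" for j x
  proof -
    have "(f ^^ j) x = (f ^^ (m * (j div m) + j mod m)) x" by (simp only: mult_div_mod_eq)
    also have "\<dots> = (f ^^ (m * (j div m))) ((f ^^ (j mod m)) x)" by (simp only: funpow_add o_apply)
    finally show ?thesis by (simp add: funpow_mult_id[OF id])
  qed
  \<comment> \<open>Exponents \<open>i < j < m\<close> with the same value would give a return after
    \<open>m - j + i < m\<close> steps, against \<open>free\<close>.\<close>
  have uniq: "i = j" if "x \<in> X" "i < m" "j < m" "(f ^^ i) x = (f ^^ j) x" for x i j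
  proof -
    have le: "\<not> i < j" if ij: "j < m" "(f ^^ i) x = (f ^^ j) x" for i j
    proof
      assume "i < j"
      have "(f ^^ (m - j + i)) x = (f ^^ (m - j)) ((f ^^ j) x)"
        unfolding ij(2)[symmetric] by (simp only: funpow_add o_apply)
      also have "\<dots> = (f ^^ (m - j + j)) x" by (simp only: funpow_add o_apply)
      also have "\<dots> = x" using ij id by simp
      finally show False using free[OF \<open>x \<in> X\<close>, of "m - j + i"] \<open>i < j\<close> ij by linarith
    qed
    then show ?thesis using le[of j i] le[of i j] that by fastforce
  qed
  define r where "r = (\<lambda>x. SOME j. j < m \<and> (f ^^ j) (b x) = x)"
  have r: "r x < m \<and> (f ^^ r x) (b x) = x" for x
  proof -
    have "x \<in> orb (b x)" unfolding orb_b by (rule self)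
    then obtain j where "x = (f ^^ j) (b x)" by (auto simp: orb_def)
    then have "j mod m < m \<and> (f ^^ (j mod m)) (b x) = x" using m by (simp add: mod)
    then show ?thesis unfolding r_def by (rule someI)
  qed
  have b_eq: "b x = b y" if "orb x = orb y" for x y using that by (simp add: b_def)
  show ?thesis
  proof (rule exI[of _ b], rule exI[of _ r], intro ballI conjI)
    fix x assume x: "x \<in> X"
    show "b x \<in> X" "(f ^^ r x) (b x) = x" using x bX r by auto
    show bf: "b (f x) = b x" using orb_eq[of 1 x] by (intro b_eq) simp
    show bb: "b (b x) = b x" by (intro b_eq orb_b)
    have "(f ^^ (Suc (r x) mod m)) (b x) = f x" using r[of x] by (simp add: mod)
    then show "r (f x) = Suc (r x) mod m"
      using r[of "f x"] m bX[OF x] by (intro uniq[of "b x"]) (auto simp: bf)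
    show "r (b x) = 0"
      using r[of "b x"] m bX[OF x] by (intro uniq[of "b x"]) (auto simp: bb)
  qed
qed

text \<open>Words that are not reduced are fixed, so that \<open>push l\<close> is a bijection of all words.\<close>

definition push :: "'a \<times> bool \<Rightarrow> ('a \<times> bool) list \<Rightarrow> ('a \<times> bool) list" where
  "push l w = (if \<not> reduced_word w then w
     else if w \<noteq> [] \<and> hd w = (fst l, \<not> snd l) then tl w else l # w)"

lemma reduced_word_Nil [simp]: "reduced_word []"
  by (simp add: reduced_word_def)

lemma reduced_word_Cons:
  "reduced_word (l # w) \<longleftrightarrow> reduced_word w \<and> (w = [] \<or> hd w \<noteq> (fst l, \<not> snd l))"
  by (cases l; cases w) (auto simp: reduced_word_def)

lemma reduced_word_push: "reduced_word (push l w) \<longleftrightarrow> reduced_word w"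
  by (cases w) (auto simp: push_def reduced_word_Cons)

lemma push_inverse: "push (e, \<not> b) (push (e, b) w) = w"
  by (cases w) (auto simp: push_def reduced_word_Cons)

lemma bij_push: "bij (push l)"
proof -
  obtain e b where l: "l = (e, b)" by force
  have "push (e, \<not> b) \<circ> push l = id" "push l \<circ> push (e, \<not> b) = id"
    using push_inverse[of e b] push_inverse[of e "\<not> b"] by (auto simp: l)
  then show ?thesis by (rule o_bij)
qed

lemma word_value_Cons:
  "word_value G ((s, e) # w) = (if e then s else inv\<^bsub>G\<^esub> s) \<otimes>\<^bsub>G\<^esub> word_value G w"
  by (simp add: word_value_def)

lemma word_value_Nil: "word_value G [] = \<one>\<^bsub>G\<^esub>"
  by (simp add: word_value_def)

lemma (in group) word_value_closed:
  "w \<in> lists (S \<times> UNIV) \<Longrightarrow> S \<subseteq> carrier G \<Longrightarrow> word_value G w \<in> carrier G"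
proof (induction w)
  case (Cons l w)
  then show ?case by (cases l) (auto simp: word_value_Cons)
qed (simp add: word_value_Nil)

lemma (in group) word_value_subgroup:
  assumes "subgroup H G" "w \<in> lists (S \<times> UNIV)" "S \<subseteq> H"
  shows "word_value (G\<lparr>carrier := H\<rparr>) w = word_value G w"
  using assms(2)
proof (induction w)
  case (Cons l w)
  then show ?case using assms(1,3) by (cases l) (auto simp: word_value_Cons m_inv_consistent)
qed (simp add: word_value_Nil)

text \<open>A cancelling pair of neighbours stays one under any relabelling, injective or
  not.\<close>

lemma reduced_word_map:
  "reduced_word (map (map_prod f id) w) \<Longrightarrow> reduced_word w"
proof (induction w)
  case (Cons l w)
  then show ?case by (cases l; cases w) (auto simp: reduced_word_Cons)
qed simp

lemma funpow_conj:
  assumes "bij f"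
  shows "(f \<circ> g \<circ> inv_into UNIV f) ^^ m = f \<circ> g ^^ m \<circ> inv_into UNIV f"
proof (induction m)
  case 0
  then show ?case using assms by (simp add: fun_eq_iff surj_f_inv_f bij_is_surj)
next
  case (Suc m)
  then show ?case using assms by (simp add: fun_eq_iff inv_f_f bij_is_inj)
qed

lemma funpow_map_prod_id:
  fixes f :: "'a \<Rightarrow> 'a"
  shows "map_prod f id ^^ m = map_prod (f ^^ m) id"
  by (induction m) (auto simp: fun_eq_iff)

context perm_action
begin

context
  fixes X :: "'x set" and x0 :: 'x
  assumes finX: "finite X" and x0: "x0 \<in> X" and kX: "\<And>i. i < n \<Longrightarrow> k i ` X = X"
    and trans: "\<And>x. x \<in> X \<Longrightarrow> \<exists>t\<in>carrier T. act t x0 = x"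
    and semireg: "\<And>i m x j. i < n \<Longrightarrow> p i = enat m \<Longrightarrow> x \<in> X \<Longrightarrow> 0 < j \<Longrightarrow> j < m \<Longrightarrow> (k i ^^ j) x \<noteq> x"
begin

text \<open>\<open>b x\<close> and \<open>g x\<close> are the source and the label of the edge of
  generator \<open>i\<close> ending in \<open>x\<close>. An infinite generator uses its own arrow
  into \<open>x\<close>; for a finite one the edge starts at the base point of the cycle and carries
  the power leading to \<open>x\<close>.\<close>

lemma edge_choice:
  assumes "i < n"
  shows "\<exists>b g. \<forall>x\<in>X. b x \<in> X \<and> g x \<in> carrier T \<and> act (g x) (b x) = x \<and>
    (p i = \<infinity> \<longrightarrow> g x = gen i) \<and>
    (p i \<noteq> \<infinity> \<longrightarrow> b (k i x) = b x \<and> g (k i x) = gen i \<otimes> g x \<and> b (b x) = b x \<and> g (b x) = \<one> \<and>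
      (\<exists>r::nat. g x = gen i [^] r))"
proof (cases "p i")
  case (enat m)
  have m: "0 < m" using two_le[OF assms] enat by (cases m) (auto simp: numeral_eq_enat)
  obtain b r where br: "\<And>x. x \<in> X \<Longrightarrow> b x \<in> X \<and> (k i ^^ r x) (b x) = x \<and> b (k i x) = b x \<and>
      r (k i x) = Suc (r x) mod m \<and> b (b x) = b x \<and> r (b x) = 0"
    using cyclic_orbit_base[OF k_order[OF assms enat] m kX[OF assms] semireg[OF assms enat]] by blast
  have red: "gen i [^] (j mod m) = gen i [^] j" for j :: nat
  proof -
    have "gen i [^] (m * (j div m) + j mod m) = (gen i [^] m) [^] (j div m) \<otimes> gen i [^] (j mod m)"
      using assms by (simp only: nat_pow_mult[symmetric] nat_pow_pow gen_closed)
    then show ?thesis using assms gen_pow_order[OF assms enat] by simp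
  qed
  have "gen i [^] r (k i x) = gen i \<otimes> gen i [^] r x" if "x \<in> X" for x
    using br[OF that] assms red nat_pow_Suc2[of "gen i" "r x"] by simp
  then show ?thesis
    using br assms by (intro exI[of _ b] exI[of _ "\<lambda>x. gen i [^] r x"]) (auto simp: enat act_gen_pow)
next
  case infinity
  have "\<exists>y\<in>X. k i y = x" if "x \<in> X" for x using kX[OF assms] that by (metis imageE)
  then obtain b where "\<forall>x\<in>X. b x \<in> X \<and> k i (b x) = x" by metis
  then show ?thesis using assms infinity by (intro exI[of _ b] exI[of _ "\<lambda>_. gen i"]) (auto simp: act_gen)
qed

text \<open>
  The stabiliser is the fundamental group of the graph on \<open>X\<close> in which every cycle of a finite
  generator is replaced by a star, and its basis consists of the edges outside a spanning tree. For
  uniqueness of reduced words, the action is lifted to \<open>X\<close> times reduced words; conjugating the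
  finite generators by the fibrewise maps \<open>Psi\<close> keeps their orders.
\<close>

lemma free_stab: "free_group (T\<lparr>carrier := stab x0\<rparr>)"
proof -

  \<comment> \<open>The graph and its spanning tree\<close>
  define Q where "Q = (\<lambda>i b g. \<forall>x\<in>X. b x \<in> X \<and> g x \<in> carrier T \<and> act (g x) (b x) = x \<and>
    (p i = \<infinity> \<longrightarrow> g x = gen i) \<and>
    (p i \<noteq> \<infinity> \<longrightarrow> b (k i x) = b x \<and> g (k i x) = gen i \<otimes> g x \<and> b (b x) = b x \<and> g (b x) = \<one> \<and>
      (\<exists>r::nat. g x = gen i [^] r)))"
  have "\<forall>i. \<exists>bg. i < n \<longrightarrow> Q i (fst bg) (snd bg)"
    using edge_choice unfolding Q_def by fastforce
  then obtain bg where "\<And>i. i < n \<Longrightarrow> Q i (fst (bg i)) (snd (bg i))" by metis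
  then obtain b0 g0 where Q: "\<And>i. i < n \<Longrightarrow> Q i (b0 i) (g0 i)"
    using that[of "\<lambda>i. fst (bg i)" "\<lambda>i. snd (bg i)"] by blast
  define src where "src = (\<lambda>(i, x). b0 i x)"
  define g where "g = (\<lambda>(i, x). g0 i x)"
  \<comment> \<open>An edge is named by its generator and its target. For a finite generator the
    loop at the centre of a star is dropped, its label being trivial.\<close>
  define E where "E = {(i, x). i < n \<and> x \<in> X \<and> (p i = \<infinity> \<or> src (i, x) \<noteq> x)}"
  have src: "src (i, x) \<in> X" and g: "g (i, x) \<in> carrier T" and g_src: "act (g (i, x)) (src (i, x)) = x"
    and inf: "p i = \<infinity> \<Longrightarrow> g (i, x) = gen i"
    and fin: "p i \<noteq> \<infinity> \<Longrightarrow> src (i, k i x) = src (i, x) \<and> g (i, k i x) = gen i \<otimes> g (i, x) \<and>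
      src (i, src (i, x)) = src (i, x) \<and> g (i, src (i, x)) = \<one> \<and> (\<exists>r::nat. g (i, x) = gen i [^] r)"
    if "i < n" "x \<in> X" for i x
    using Q[OF that(1)] that(2) by (auto simp: Q_def src_def g_def)
  have kx: "k i x \<in> X" if "i < n" "x \<in> X" for i x using kX that by blast
  have src_k: "k i (src (i, x)) = x" if "i < n" "x \<in> X" "p i = \<infinity>" for i x
    using g_src[OF that(1,2)] inf[OF that] that(1) by (simp add: act_gen)
  have src_k': "src (i, k i x) = x" if "i < n" "x \<in> X" "p i = \<infinity>" for i x
    using src_k[OF that(1) kx[OF that(1,2)] that(3)] bij_k[OF that(1)] by (simp add: bij_def inj_eq)
  \<comment> \<open>A vertex set whose boundary no edge crosses is invariant under all generators,
    hence contains the orbit of \<open>x0\<close>. For a finite generator this holds because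
    \<open>x\<close> and \<open>k i x\<close> hang on the same centre.\<close>
  have conn: "\<exists>e\<in>E. (src e \<in> V) \<noteq> (snd e \<in> V)" if V: "x0 \<in> V" "V \<subset> X" for V
  proof (rule ccontr)
    assume "\<not> ?thesis"
    then have all: "src (i, x) \<in> V \<longleftrightarrow> x \<in> V" if "i < n" "x \<in> X" for i x
      using that by (cases "(i, x) \<in> E") (fastforce simp: E_def)+
    have kV: "k i x \<in> V \<longleftrightarrow> x \<in> V" if "i < n" "x \<in> X" for i x
      using all[of i x] all[OF that(1) kx[OF that]] fin[OF that] src_k'[OF that] that
      by (cases "p i = \<infinity>") auto
    have "act t x0 \<in> V" if "t \<in> carrier T" for t
      using that
    proof (induction t rule: T_induct)
      case (gen i t)
      then show ?case using kV V by (auto simp: act_mult act_gen)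
    next
      case (inv_gen i t)
      let ?y = "act (inv (gen i)) (act t x0)"
      have "?y \<in> X" using act_in[OF kX, of "inv (gen i)" "act t x0"] inv_gen V by auto
      moreover have "k i ?y = act t x0" using inv_gen act_inv_right[of "gen i"] by (simp add: act_gen)
      ultimately show ?case using kV[of i ?y] inv_gen by (simp add: act_mult)
    qed (use V in simp)
    then show False using trans V by blast
  qed
  have E_in: "\<And>e. e \<in> E \<Longrightarrow> src e \<in> X \<and> snd e \<in> X \<and> g e \<in> carrier T"
    and E_fst: "\<And>e. e \<in> E \<Longrightarrow> fst e < n"
    using src g by (auto simp: E_def)
  obtain F t where F: "F \<subseteq> E" and edge: "\<And>e. e \<in> F \<Longrightarrow> g e \<otimes> t (src e) = t (snd e)" and t0: "t x0 = \<one>"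
    and path: "\<And>x. x \<in> X \<Longrightarrow> tree_path T src snd g F x0 x (t x)"
    using spanning_tree[of X x0 E src snd g, OF finX x0 E_in conn] by blast
  have path_closed: "u \<in> carrier T" if "tree_path T src snd g F x0 x u" for x u
    by (rule tree_path_closed[OF that]) (use F E_in in blast)
  have t: "t x \<in> carrier T" if "x \<in> X" for x
    by (rule path_closed[OF path[OF that]])

  \<comment> \<open>The lift of the action to words\<close>
  define D where "D = (\<lambda>e. if e \<in> E - F then push (e, True) else id)"
  have bij_D: "bij (D e)" for e by (simp add: D_def bij_push)
  define Psi where "Psi = (\<lambda>i (x, w). (x :: 'x, D (i, x) w))"
  have bij_Psi: "bij (Psi i)" for i
  proof (rule o_bij)
    show "(\<lambda>(x, w). (x, inv_into UNIV (D (i, x)) w)) \<circ> Psi i = id" "Psi i \<circ> (\<lambda>(x, w). (x, inv_into UNIV (D (i, x)) w)) = id"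
      using bij_D by (auto simp: Psi_def fun_eq_iff inv_f_f bij_is_inj surj_f_inv_f bij_is_surj)
  qed
  \<comment> \<open>Arriving at \<open>x\<close> from its source has to apply
    \<open>D (i, x)\<close>, which pushes a letter on edges outside the tree only. Composition with
    \<open>Psi i\<close> achieves this for an infinite generator; for a finite one conjugation does,
    since \<open>Psi i\<close> is trivial over the centre of a star.\<close>
  define kk where "kk = (\<lambda>i. if p i = \<infinity> then Psi i \<circ> map_prod (k i) id
    else Psi i \<circ> map_prod (k i) id \<circ> inv_into UNIV (Psi i))"
  have bij_map: "bij (map_prod (k i) (id :: ((nat \<times> 'x) \<times> bool) list \<Rightarrow> _))" if "i < n" for i
    using bij_k[OF that] by (intro bij_betw_map_prod[of _ UNIV UNIV _ UNIV UNIV, simplified]) auto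
  interpret lift: perm_action n p T kk
  proof
    show "bij (kk i)" if "i < n" for i
      using bij_Psi[of i] bij_map[OF that] by (auto simp: kk_def bij_comp bij_imp_bij_inv)
    show "kk i ^^ m = id" if "i < n" "p i = enat m" for i m
    proof -
      have "kk i ^^ m = Psi i \<circ> inv_into UNIV (Psi i)"
        using that by (simp add: kk_def funpow_conj[OF bij_Psi] funpow_map_prod_id k_order map_prod.id)
      then show ?thesis using bij_Psi by (simp add: fun_eq_iff surj_f_inv_f bij_is_surj)
    qed
  qed
  have kk_inf: "kk i (x, w) = Psi i (k i x, w)" if "p i = \<infinity>" for i x w
    using that by (simp add: kk_def)
  have kk_pow: "kk i ^^ r = Psi i \<circ> map_prod (k i ^^ r) id \<circ> inv_into UNIV (Psi i)" if "p i \<noteq> \<infinity>" for i r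
    using that by (auto simp: kk_def funpow_conj[OF bij_Psi] funpow_map_prod_id)
  have lift_g: "lift.act (g (i, x)) (src (i, x), w) = (x, D (i, x) w)" if "i < n" "x \<in> X" for i x w
  proof (cases "p i = \<infinity>")
    case True
    then show ?thesis using inf[OF that True] src_k[OF that True] that by (simp add: lift.act_gen kk_inf Psi_def)
  next
    case False
    from fin[OF that False] obtain r :: nat where r: "g (i, x) = gen i [^] r" by blast
    have "(i, src (i, x)) \<notin> E" using False fin[OF that] by (auto simp: E_def)
    then have "Psi i (src (i, x), w) = (src (i, x), w)" by (simp add: Psi_def D_def)
    then have "inv_into UNIV (Psi i) (src (i, x), w) = (src (i, x), w)" using inv_f_f[OF bij_is_inj[OF bij_Psi[of i]]] by metis
    moreover have "(k i ^^ r) (src (i, x)) = x" using g_src[OF that] that by (simp add: r act_gen_pow)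
    ultimately show ?thesis using False that
      by (simp add: r lift.act_gen_pow kk_pow Psi_def)
  qed
  \<comment> \<open>Tree edges leave the word alone, so walks in the tree move only the point of
    \<open>X\<close>.\<close>
  have lift_path: "lift.act u (x0, w) = (x, w)" if "tree_path T src snd g F x0 x u" for x u w
    using that
  proof induction
    case root
    show ?case by simp
  next
    case (forward e u)
    have u: "u \<in> carrier T" by (rule path_closed[OF forward.hyps(2)])
    have e: "e \<in> E" using forward F by blast
    have "lift.act (g e) (src e, w) = (snd e, w)"
      using lift_g[of "fst e" "snd e" w] E_in[OF e] E_fst[OF e] forward.hyps(1) by (simp add: D_def)
    then show ?case using forward u E_in[OF e] by (simp add: lift.act_mult)
  next
    case (backward e u)
    have u: "u \<in> carrier T" by (rule path_closed[OF backward.hyps(2)])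
    have e: "e \<in> E" using backward F by blast
    have "lift.act (g e) (src e, w) = (snd e, w)"
      using lift_g[of "fst e" "snd e" w] E_in[OF e] E_fst[OF e] backward.hyps(1) by (simp add: D_def)
    then show ?case using backward u E_in[OF e] by (simp add: lift.act_mult lift.act_inv_eq_iff)
  qed

  \<comment> \<open>Schreier generators\<close>
  \<comment> \<open>The loop from \<open>x0\<close> through the tree to the source of
    \<open>e\<close>, along \<open>e\<close>, and back through the tree; the factors act from right
    to left.\<close>
  define s where "s = (\<lambda>e. inv (t (snd e)) \<otimes> g e \<otimes> t (src e))"
  have s: "s (i, x) \<in> carrier T" if "i < n" "x \<in> X" for i x
    using that src g t by (simp add: s_def)
  have lift_s: "lift.act (s e) (x0, w) = (x0, D e w)" if "e \<in> E" for e w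
  proof -
    from that obtain i x where e: "e = (i, x)" "i < n" "x \<in> X" by (auto simp: E_def)
    then show ?thesis using src g t lift_g[OF e(2,3)] lift_path[OF path]
      by (simp add: s_def lift.act_mult lift.act_inv_eq_iff)
  qed
  have s_stab: "s e \<in> stab x0" if "e \<in> E" for e
  proof -
    from that obtain i x where e: "e = (i, x)" "i < n" "x \<in> X" by (auto simp: E_def)
    have path_act: "act u x0 = y" if "tree_path T src snd g F x0 y u" for y u
      using that
    proof induction
      case (forward e u)
      have u: "u \<in> carrier T" by (rule path_closed[OF forward.hyps(2)])
      have e: "e \<in> E" using forward F by blast
      have "act (g e) (src e) = snd e" using g_src[of "fst e" "snd e"] E_in[OF e] E_fst[OF e] by simp
      then show ?case using forward u E_in[OF e] by (simp add: act_mult act_inv_eq_iff)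
    next
      case (backward e u)
      have u: "u \<in> carrier T" by (rule path_closed[OF backward.hyps(2)])
      have e: "e \<in> E" using backward F by blast
      have "act (g e) (src e) = snd e" using g_src[of "fst e" "snd e"] E_in[OF e] E_fst[OF e] by simp
      then show ?case using backward u E_in[OF e] by (simp add: act_mult act_inv_eq_iff)
    qed simp
    show ?thesis using e src g t g_src path_act[OF path] s[OF e(2,3)]
      by (simp add: stab_def s_def act_mult act_inv_eq_iff)
  qed
  have s_trivial: "s (i, x) = \<one>" if "i < n" "x \<in> X" "(i, x) \<notin> E - F" for i x
  proof (cases "(i, x) \<in> F")
    case True
    have "t x = g (i, x) \<otimes> t (src (i, x))" using edge[OF True] by simp
    then show ?thesis using that t src g by (simp add: s_def m_assoc)
  next
    case False
    then have "src (i, x) = x" "p i \<noteq> \<infinity>" using that by (auto simp: E_def)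
    then have "g (i, x) = \<one>" using fin[OF that(1,2)] by simp
    with \<open>src (i, x) = x\<close> show ?thesis using that t by (simp add: s_def)
  qed

  \<comment> \<open>Generation of the stabiliser\<close>
  define L where "L = E - F"
  define val where "val = (\<lambda>w. word_value T (map (map_prod s id) w))"
  define V where "V = val ` {w \<in> lists (L \<times> UNIV). reduced_word w}"
  have sL: "s e \<in> carrier T" if "e \<in> L" for e using that s by (auto simp: L_def E_def)
  have lists: "map (map_prod s id) w \<in> lists (s ` L \<times> UNIV)" if "w \<in> lists (L \<times> UNIV)" for w
    using that by (induction w) auto
  have val_closed: "val w \<in> carrier T" if "w \<in> lists (L \<times> UNIV)" for w
    unfolding val_def by (rule word_value_closed[OF lists[OF that]]) (use sL in blast)
  have val_push: "val (push (e, \<epsilon>) w) = (if \<epsilon> then s e else inv (s e)) \<otimes> val w"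
    if w: "w \<in> lists (L \<times> UNIV)" "reduced_word w" "e \<in> L" for e \<epsilon> w
  proof (cases "w \<noteq> [] \<and> hd w = (e, \<not> \<epsilon>)")
    case True
    then obtain v where v: "w = (e, \<not> \<epsilon>) # v" by (cases w) auto
    then have "val v \<in> carrier T" using w val_closed by auto
    then show ?thesis using w sL by (simp add: v push_def val_def word_value_Cons m_assoc[symmetric])
  next
    case False
    then show ?thesis using w by (auto simp: push_def val_def word_value_Cons)
  qed
  \<comment> \<open>Multiplication by a loop corresponds to \<open>push\<close> on words, which
    keeps them reduced; the loops of all edges not in \<open>L\<close> are trivial.\<close>
  have V_closed: "s (i, x) \<otimes> v \<in> V" "inv (s (i, x)) \<otimes> v \<in> V" if "i < n" "x \<in> X" "v \<in> V" for i x v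
  proof -
    from that(3) obtain w where w: "w \<in> lists (L \<times> UNIV)" "reduced_word w" "v = val w" by (auto simp: V_def)
    have "(if \<epsilon> then s (i, x) else inv (s (i, x))) \<otimes> v \<in> V" for \<epsilon>
    proof (cases "(i, x) \<in> L")
      case True
      have "push ((i, x), \<epsilon>) w \<in> lists (L \<times> UNIV)" using w True by (cases w) (auto simp: push_def)
      then show ?thesis using val_push[OF w(1,2) True, of \<epsilon>] w
        by (auto simp: V_def reduced_word_push simp del: if_split intro!: image_eqI[of _ val "push ((i, x), \<epsilon>) w"])
    next
      case False
      then show ?thesis using s_trivial[OF that(1,2)] that(3) val_closed w by (simp add: L_def)
    qed
    from this[of True] this[of False] show "s (i, x) \<otimes> v \<in> V" "inv (s (i, x)) \<otimes> v \<in> V" by simp_all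
  qed
  have Vc: "v \<in> carrier T" if "v \<in> V" for v using that val_closed by (auto simp: V_def)
  have actX: "act u x \<in> X" if "u \<in> carrier T" "x \<in> X" for u x
    using act_in[OF kX] that by blast
  \<comment> \<open>One generator step between tree representatives is a product of at most two
    loops. A finite generator passes through the centre of the star: back along the edge to
    \<open>x\<close>, then out along the edge to \<open>k i x\<close>.\<close>
  have step: "inv (t (k i x)) \<otimes> gen i \<otimes> t x \<otimes> v \<in> V" "inv (t x) \<otimes> inv (gen i) \<otimes> t (k i x) \<otimes> v \<in> V"
    if "i < n" "x \<in> X" "v \<in> V" for i x v
  proof -
    let ?y = "k i x"
    note y = kx[OF that(1,2)]
    define c where "c = inv (t ?y) \<otimes> gen i \<otimes> t x"
    have c: "c \<in> carrier T" using that t y by (simp add: c_def)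
    have inv_c: "inv (t x) \<otimes> inv (gen i) \<otimes> t ?y = inv c"
      using that t y by (simp add: c_def inv_mult_group m_assoc)
    have "c \<otimes> v \<in> V \<and> inv c \<otimes> v \<in> V"
    proof (cases "p i = \<infinity>")
      case True
      have "c = s (i, ?y)" using inf[OF that(1) y True] src_k'[OF that(1,2) True] by (simp add: c_def s_def)
      then show ?thesis using V_closed[OF that(1) y that(3)] by simp
    next
      case False
      let ?z = "src (i, x)"
      have "s (i, ?y) = inv (t ?y) \<otimes> (gen i \<otimes> g (i, x)) \<otimes> t ?z" using fin[OF that(1,2) False] by (simp add: s_def)
      also have "\<dots> = c \<otimes> s (i, x)"
      proof -
        have "t x \<otimes> (inv (t x) \<otimes> u) = u" if "u \<in> carrier T" for u
          using that t[OF \<open>x \<in> X\<close>] by (simp add: m_assoc[symmetric])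
        then show ?thesis using that t y src g by (simp add: c_def s_def m_assoc)
      qed
      finally have "c = s (i, ?y) \<otimes> inv (s (i, x))" using c s that y by (simp add: m_assoc)
      then have "c \<otimes> v = s (i, ?y) \<otimes> (inv (s (i, x)) \<otimes> v)" "inv c \<otimes> v = s (i, x) \<otimes> (inv (s (i, ?y)) \<otimes> v)"
        using s that y Vc by (simp_all add: m_assoc inv_mult_group)
      then show ?thesis using V_closed that y by simp
    qed
    then show "inv (t ?y) \<otimes> gen i \<otimes> t x \<otimes> v \<in> V" "inv (t x) \<otimes> inv (gen i) \<otimes> t ?y \<otimes> v \<in> V"
      by (simp_all add: inv_c c_def)
  qed
  \<comment> \<open>Schreier rewriting: \<open>u\<close> is compared with the tree representative of
    the point it leads to, which is \<open>\<one>\<close> if \<open>u\<close> fixes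
    \<open>x0\<close>.\<close>
  have gen_V: "inv (t (act u x0)) \<otimes> u \<in> V" if "u \<in> carrier T" for u
    using that
  proof (induction u rule: T_induct)
    case one
    have "val [] \<in> V" unfolding V_def by (rule imageI) simp
    then show ?case by (simp add: t0 val_def word_value_Nil)
  next
    case (gen i u)
    have cancel: "t (act u x0) \<otimes> (inv (t (act u x0)) \<otimes> u) = u"
      using gen t actX[OF _ x0] by (simp add: m_assoc[symmetric])
    show ?case using step(1)[OF gen(1) actX[OF gen(2) x0] gen(3)] gen t actX[OF gen(2) x0] kx cancel
      by (simp add: act_mult act_gen m_assoc)
  next
    case (inv_gen i u)
    let ?y = "act (inv (gen i)) (act u x0)"
    have y: "?y \<in> X" using actX x0 inv_gen by simp
    have ky: "k i ?y = act u x0" using inv_gen act_inv_right[of "gen i"] by (simp add: act_gen)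
    have cancel: "t (act u x0) \<otimes> (inv (t (act u x0)) \<otimes> u) = u"
      using inv_gen t actX[OF _ x0] by (simp add: m_assoc[symmetric])
    show ?case using step(2)[OF inv_gen(1) y inv_gen(3)] inv_gen t actX[OF inv_gen(2) x0] y cancel
      by (simp add: act_mult ky m_assoc)
  qed

  \<comment> \<open>Uniqueness of reduced words\<close>
  \<comment> \<open>The lifted action of the value writes \<open>w\<close> onto the empty word, so
    \<open>w\<close> can be read off from its value.\<close>
  have lift_val: "lift.act (val w) (x0, []) = (x0, w)" if "w \<in> lists (L \<times> UNIV)" "reduced_word w" for w
    using that
  proof (induction w rule: list.induct)
    case Nil
    then show ?case by (simp add: val_def word_value_Nil)
  next
    case (Cons l w)
    obtain e \<epsilon> where l: "l = (e, \<epsilon>)" by (cases l) blast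
    have e: "e \<in> L" and w: "w \<in> lists (L \<times> UNIV)" "reduced_word w" using Cons.prems by (simp_all add: l reduced_word_Cons)
    have push: "push (e, \<epsilon>) w = l # w" using Cons.prems by (auto simp: l push_def reduced_word_Cons)
    have eE: "e \<in> E" and D: "D e = push (e, True)" using e by (auto simp: L_def D_def)
    have vw: "val w \<in> carrier T" "s e \<in> carrier T" using w val_closed sL[OF e] by auto
    have "val (l # w) = (if \<epsilon> then s e else inv (s e)) \<otimes> val w" by (simp add: l val_def word_value_Cons)
    then have "lift.act (val (l # w)) (x0, []) = lift.act (if \<epsilon> then s e else inv (s e)) (x0, w)"
      using vw Cons.IH[OF w] by (simp add: lift.act_mult)
    also have "\<dots> = (x0, push (e, \<epsilon>) w)"
      using vw lift_s[OF eE] push_inverse[of e False w] by (auto simp: D lift.act_inv_eq_iff)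
    finally show ?case by (simp add: push)
  qed
  let ?H = "T\<lparr>carrier := stab x0\<rparr>"
  note sub = subgroup_stab[of x0]
  have S_sub: "s ` L \<subseteq> stab x0" using s_stab by (auto simp: L_def)
  have "free_basis ?H (s ` L)"
    unfolding free_basis_def
  proof (intro conjI ballI ex_ex1I)
    show "s ` L \<subseteq> carrier ?H" using S_sub by simp
    fix h assume "h \<in> carrier ?H"
    then have h: "h \<in> carrier T" "act h x0 = x0" by (auto simp: stab_def)
    have "h \<in> V" using gen_V[OF h(1)] h by (simp add: t0)
    then obtain w where w: "w \<in> lists (L \<times> UNIV)" "reduced_word w" "h = val w" by (auto simp: V_def)
    \<comment> \<open>Distinct edges push distinct letters. Injectivity of \<open>s\<close> then
      keeps relabelled words reduced.\<close>
    have inj: "inj_on s L"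
    proof (rule inj_onI)
      fix e e' assume e: "e \<in> L" "e' \<in> L" "s e = s e'"
      have "lift.act (s e) (x0, []) = (x0, [(e, True)])" if "e \<in> L" for e
        using lift_val[of "[(e, True)]"] that sL by (simp add: val_def word_value_Cons word_value_Nil reduced_word_Cons)
      then show "e = e'" using e by (metis Pair_inject list.inject)
    qed
    have red: "reduced_word (map (map_prod s id) w)" if "w \<in> lists (L \<times> UNIV)" "reduced_word w" for w
      using that
    proof (induction w)
      case (Cons l w)
      then show ?case by (cases l; cases w) (auto simp: reduced_word_Cons dest: inj_onD[OF inj])
    qed simp
    show "\<exists>w. w \<in> lists (s ` L \<times> UNIV) \<and> reduced_word w \<and> word_value ?H w = h"
    proof (intro exI conjI)
      show "map (map_prod s id) w \<in> lists (s ` L \<times> UNIV)" by (rule lists[OF w(1)])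
      then show "word_value ?H (map (map_prod s id) w) = h"
        using word_value_subgroup[OF sub _ S_sub] w by (simp add: val_def)
      show "reduced_word (map (map_prod s id) w)" using red w by blast
    qed
    fix u v assume u: "u \<in> lists (s ` L \<times> UNIV) \<and> reduced_word u \<and> word_value ?H u = h"
      and v: "v \<in> lists (s ` L \<times> UNIV) \<and> reduced_word v \<and> word_value ?H v = h"
    have label: "\<exists>w'. w' \<in> lists (L \<times> UNIV) \<and> w = map (map_prod s id) w'" if "w \<in> lists (s ` L \<times> UNIV)" for w :: "(_ \<times> bool) list"
    proof (intro exI conjI)
      show "map (map_prod (inv_into L s) id) w \<in> lists (L \<times> UNIV)"
        using that by (induction w) (auto simp: inv_into_into)
      show "w = map (map_prod s id) (map (map_prod (inv_into L s) id) w)"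
        using that by (induction w) (auto simp: f_inv_into_f)
    qed
    obtain u' v' where u': "u' \<in> lists (L \<times> UNIV)" "u = map (map_prod s id) u'"
      and v': "v' \<in> lists (L \<times> UNIV)" "v = map (map_prod s id) v'"
      using label u v by metis
    have "reduced_word u'" "reduced_word v'" using u v u' v' reduced_word_map by blast+
    moreover have "val u' = h" "val v' = h"
      using u v unfolding u'(2) v'(2) val_def by (metis word_value_subgroup[OF sub _ S_sub])+
    ultimately show "u = v" using lift_val u' v' by (metis Pair_inject)
  qed
  then show ?thesis using subgroup.subgroup_is_group[OF sub group_T] by (auto simp: free_group_def)
qed

end

end

section \<open>Index, conjugacy and normalisers of stabilisers\<close>

context cyclic_free_product
begin

text \<open>A subgroup is determined by the action of the generators on its numbered cosets.\<close>

lemma finite_subgroups_bounded_index: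
  "finite {H. subgroup H T \<and> finite (rcosets H) \<and> card (rcosets H) \<le> d}"
proof -
  \<comment> \<open>A code consists of the number of cosets, the number given to the coset
    \<open>H\<close>, and the table of right multiplication by the generators.\<close>
  define code where "code = (\<lambda>H c. case c of (m :: nat, a :: nat, \<delta>) \<Rightarrow>
    \<exists>e. bij_betw e (rcosets H) {..<m} \<and> e H = a \<and>
      (\<forall>C\<in>rcosets H. \<forall>i<n. \<delta> (i, e C) = e (C #> gen i)))"
  let ?\<H> = "{H. subgroup H T \<and> finite (rcosets H) \<and> card (rcosets H) \<le> d}"
  let ?codes = "{..d} \<times> {..<d} \<times> (PiE ({..<n} \<times> {..<d}) (\<lambda>_. {..<d}))"
  have closed: "C #> g \<in> rcosets H" if "subgroup H T" "C \<in> rcosets H" "g \<in> carrier T" for H C g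
    using that subgroup.subset[OF that(1)] by (auto simp: RCOSETS_def coset_mult_assoc)
  have coset: "H #> t \<in> rcosets H" if "subgroup H T" "t \<in> carrier T" for H t
    using that by (auto simp: RCOSETS_def)
  have one: "H \<in> rcosets H" if "subgroup H T" for H
    using coset[OF that, of \<one>] subgroup.subset[OF that] by simp
  have ex: "\<exists>c\<in>?codes. code H c" if "H \<in> ?\<H>" for H
  proof -
    define m where "m = card (rcosets H)"
    have H: "subgroup H T" "finite (rcosets H)" "m \<le> d" using that by (auto simp: m_def)
    obtain e where e: "bij_betw e (rcosets H) {..<m}"
      using ex_bij_betw_finite_nat[OF H(2)] by (auto simp: m_def atLeast0LessThan)
    \<comment> \<open>The table is padded with 0 from \<open>m\<close> on, so that the codes for all
      indices up to \<open>d\<close> lie in one finite set.\<close>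
    define \<delta> where "\<delta> = (\<lambda>(i, j)\<in>{..<n} \<times> {..<d}.
      if j < m then e (inv_into (rcosets H) e j #> gen i) else 0)"
    have eC: "e C < m" if "C \<in> rcosets H" for C using e that by (auto simp: bij_betw_def)
    have "\<delta> (i, e C) = e (C #> gen i)" if "C \<in> rcosets H" "i < n" for C i
      using that eC[OF that(1)] H(3) e by (auto simp: \<delta>_def bij_betw_def inv_into_f_f)
    moreover have "\<delta> \<in> PiE ({..<n} \<times> {..<d}) (\<lambda>_. {..<d})"
    proof (rule PiE_I)
      fix x assume "x \<in> {..<n} \<times> {..<d}"
      then obtain i j where x: "x = (i, j)" "i < n" "j < d" by auto
      have "e (inv_into (rcosets H) e j #> gen i) < d" if "j < m"
      proof -
        have "inv_into (rcosets H) e j \<in> rcosets H"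
          using e that by (intro inv_into_into) (auto simp: bij_betw_def)
        then show ?thesis using eC[OF closed[OF H(1)]] x H(3) gen_closed by fastforce
      qed
      then show "\<delta> x \<in> {..<d}" using x by (auto simp: \<delta>_def)
    qed (auto simp: \<delta>_def)
    ultimately have "code H (m, e H, \<delta>)" using e by (auto simp: code_def)
    moreover have "e H < d" using eC[OF one[OF H(1)]] H(3) by simp
    ultimately show ?thesis using \<open>\<delta> \<in> _\<close> H(3) by (intro bexI[of _ "(m, e H, \<delta>)"]) auto
  qed
  have uniq: "H = H'" if "code H c" "code H' c" "subgroup H T" "subgroup H' T" for H H' c
  proof -
    obtain m a \<delta> where c: "c = (m, a, \<delta>)" by (cases c) blast
    from that(1) c obtain e where e: "bij_betw e (rcosets H) {..<m}" "e H = a"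
      "\<And>C i. C \<in> rcosets H \<Longrightarrow> i < n \<Longrightarrow> \<delta> (i, e C) = e (C #> gen i)" by (auto simp: code_def)
    from that(2) c obtain e' where e': "bij_betw e' (rcosets H') {..<m}" "e' H' = a"
      "\<And>C i. C \<in> rcosets H' \<Longrightarrow> i < n \<Longrightarrow> \<delta> (i, e' C) = e' (C #> gen i)" by (auto simp: code_def)
    have inj: "inj_on e (rcosets H)" "inj_on e' (rcosets H')" using e(1) e'(1) by (auto simp: bij_betw_def)
    have sub: "H \<subseteq> carrier T" "H' \<subseteq> carrier T" using that subgroup.subset by blast+
    \<comment> \<open>The inverse turns the left multiplications of \<open>T_induct\<close> into
      right multiplications of cosets.\<close>
    have "e (H #> inv t) = e' (H' #> inv t)" if "t \<in> carrier T" for t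
      using that
    proof (induction t rule: T_induct)
      case one
      then show ?case using e(2) e'(2) sub by simp
    next
      case (gen i t)
      let ?D = "H #> inv (gen i \<otimes> t)" and ?D' = "H' #> inv (gen i \<otimes> t)"
      have cancel: "inv t \<otimes> inv (gen i) \<otimes> gen i = inv t" using gen by (simp add: m_assoc)
      have D: "?D \<in> rcosets H" "?D' \<in> rcosets H'" using gen coset \<open>subgroup H T\<close> \<open>subgroup H' T\<close> by simp_all
      have DC: "?D #> gen i = H #> inv t" "?D' #> gen i = H' #> inv t"
        using gen sub by (simp_all add: coset_mult_assoc inv_mult_group cancel)
      have "\<delta> (i, e ?D) = \<delta> (i, e' ?D')"
        using e(3)[OF D(1) gen(1)] e'(3)[OF D(2) gen(1)] DC gen.IH by simp
      \<comment> \<open>The table leads from the new coset to the known one, so the step has to be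
        undone: \<open>E\<close> is the coset of \<open>H\<close> numbered like \<open>?D'\<close>,
        and cancelling \<open>gen i\<close> gives \<open>E = ?D\<close>.\<close>
      moreover have "e' ?D' < m" using e'(1) D by (auto simp: bij_betw_def)
      then obtain E where E: "E \<in> rcosets H" "e E = e' ?D'" using e(1) by (auto simp: bij_betw_def image_iff) (metis imageE lessThan_iff)
      ultimately have "e (E #> gen i) = e (?D #> gen i)" using e(3)[OF E(1) gen(1)] e(3)[OF D(1) gen(1)] by simp
      then have "E #> gen i = ?D #> gen i"
        using inj(1) closed[OF \<open>subgroup H T\<close>] E D gen by (auto dest: inj_onD)
      then have "E #> gen i #> inv (gen i) = ?D #> gen i #> inv (gen i)" by simp
      moreover have "C #> gen i #> inv (gen i) = C" if "C \<in> rcosets H" for C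
        using that gen sub(1)
        by (auto simp: RCOSETS_def coset_mult_assoc m_assoc)
      ultimately have "E = ?D" using E D by simp
      then show ?case using E by simp
    next
      case (inv_gen i t)
      have "H #> inv (inv (gen i) \<otimes> t) = H #> inv t #> gen i" "H' #> inv (inv (gen i) \<otimes> t) = H' #> inv t #> gen i"
        using inv_gen sub by (simp_all add: coset_mult_assoc inv_mult_group)
      then show ?case
        using e(3)[OF coset[OF \<open>subgroup H T\<close>, of "inv t"] inv_gen(1)]
          e'(3)[OF coset[OF \<open>subgroup H' T\<close>, of "inv t"] inv_gen(1)] inv_gen by simp
    qed
    then have eq: "e (H #> t) = e' (H' #> t)" if "t \<in> carrier T" for t
      using inv_inv[OF that] inv_closed[OF that] by metis
    have "t \<in> H \<longleftrightarrow> t \<in> H'" if t: "t \<in> carrier T" for t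
    proof -
      have mem: "t \<in> K \<longleftrightarrow> K #> t = K" if "subgroup K T" for K
        using that t coset_join1 coset_join2 subgroup.subset by metis
      have "H #> t = H \<longleftrightarrow> e (H #> t) = e H"
        using inj(1) coset one \<open>subgroup H T\<close> t by (auto dest: inj_onD)
      moreover have "H' #> t = H' \<longleftrightarrow> e' (H' #> t) = e' H'"
        using inj(2) coset one \<open>subgroup H' T\<close> t by (auto dest: inj_onD)
      ultimately show ?thesis using mem \<open>subgroup H T\<close> \<open>subgroup H' T\<close> eq[OF t] e(2) e'(2) by simp
    qed
    then show ?thesis using sub by blast
  qed
  have "finite ?codes" by (intro finite_cartesian_product finite_PiE) auto
  moreover have "?\<H> \<subseteq> (\<lambda>c. THE H. code H c \<and> subgroup H T) ` ?codes"
  proof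
    fix H assume H: "H \<in> ?\<H>"
    then obtain c where c: "c \<in> ?codes" "code H c" using ex by blast
    have "(THE H. code H c \<and> subgroup H T) = H"
      using c H uniq by (intro the_equality) blast+
    then show "H \<in> (\<lambda>c. THE H. code H c \<and> subgroup H T) ` ?codes" using c by blast
  qed
  ultimately show ?thesis by (rule finite_surj)
qed

end

context perm_action
begin

text \<open>The coset of \<open>u\<close> depends only on the point \<open>act (inv u) x0\<close>,
  so there are at most as many cosets as points.\<close>

lemma rcosets_stab:
  assumes X: "finite X" and kX: "\<And>i. i < n \<Longrightarrow> k i ` X = X" and x0: "x0 \<in> X"
    and trans: "\<And>x. x \<in> X \<Longrightarrow> \<exists>t\<in>carrier T. act t x0 = x"
  shows "finite (rcosets (stab x0))" "card (rcosets (stab x0)) \<le> card X"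
proof -
  have "\<forall>x\<in>X. \<exists>t. t \<in> carrier T \<and> act t x0 = x" using trans by blast
  then obtain t where t: "\<And>x. x \<in> X \<Longrightarrow> t x \<in> carrier T \<and> act (t x) x0 = x" by metis
  have sub: "rcosets (stab x0) \<subseteq> (\<lambda>x. stab x0 #> inv (t x)) ` X"
  proof
    fix C assume "C \<in> rcosets (stab x0)"
    then obtain u where u: "u \<in> carrier T" "C = stab x0 #> u" by (auto simp: RCOSETS_def)
    define x where "x = act (inv u) x0"
    have x: "x \<in> X" using act_in[OF kX, of "inv u" x0] u x0 by (simp add: x_def)
    have "u \<otimes> t x \<in> stab x0" using t[OF x] u by (simp add: stab_def act_mult) (simp add: x_def u)
    moreover have "u = (u \<otimes> t x) \<otimes> inv (t x)" using t[OF x] u by (simp add: m_assoc)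
    ultimately have "u \<in> stab x0 #> inv (t x)" unfolding r_coset_def by blast
    then have "stab x0 #> inv (t x) = C"
      using repr_independence[of u "stab x0" "inv (t x)"] subgroup_stab t[OF x] u by simp
    then show "C \<in> (\<lambda>x. stab x0 #> inv (t x)) ` X" using x by blast
  qed
  show "finite (rcosets (stab x0))" by (rule finite_subset[OF sub finite_imageI[OF X]])
  show "card (rcosets (stab x0)) \<le> card X"
    using card_mono[OF finite_imageI[OF X] sub] card_image_le[OF X] le_trans by blast
qed

text \<open>The map sends \<open>act t x0\<close> to the image of \<open>y0\<close> under the same
  \<open>t\<close>; equality of the stabilisers makes it well defined.\<close>

lemma equivariant_map:
  assumes k': "perm_action n p T k'"
    and kX: "\<And>i. i < n \<Longrightarrow> k i ` X = X"
    and trans: "\<And>x. x \<in> X \<Longrightarrow> \<exists>t\<in>carrier T. act t x0 = x"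
    and k'Y: "\<And>i. i < n \<Longrightarrow> k' i ` Y = Y" and y0: "y0 \<in> Y"
    and stab: "stab x0 = perm_action.stab n p T k' y0"
  shows "\<exists>f. f x0 = y0 \<and> (\<forall>x\<in>X. f x \<in> Y \<and> (\<forall>i<n. f (k i x) = k' i (f x)))"
proof -
  interpret B: perm_action n p T k' by (rule k')
  define f where "f = (\<lambda>x. B.act (SOME t. t \<in> carrier T \<and> act t x0 = x) y0)"
  have f: "f (act t x0) = B.act t y0" if t: "t \<in> carrier T" for t
  proof -
    define u where "u = (SOME u. u \<in> carrier T \<and> act u x0 = act t x0)"
    have u: "u \<in> carrier T \<and> act u x0 = act t x0"
      unfolding u_def by (rule someI[of _ t]) (simp add: t)
    then have "inv t \<otimes> u \<in> stab x0" using t by (simp add: stab_def act_mult)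
    then have "B.act u y0 = B.act t y0" using t u by (simp add: stab B.stab_def B.act_mult B.act_inv_eq_iff)
    then show ?thesis by (simp add: f_def u_def)
  qed
  have "f x \<in> Y \<and> (\<forall>i<n. f (k i x) = k' i (f x))" if x: "x \<in> X" for x
  proof -
    obtain t where t: "t \<in> carrier T" "act t x0 = x" using trans[OF x] by blast
    have "f (k i x) = k' i (f x)" if "i < n" for i
      using f[OF t(1)] f[of "gen i \<otimes> t"] t that by (simp add: act_mult act_gen B.act_mult B.act_gen)
    moreover have "f x \<in> Y" using f[OF t(1)] t B.act_in[OF k'Y t(1) y0] by simp
    ultimately show ?thesis by blast
  qed
  moreover have "f x0 = y0" using f[of \<one>] by simp
  ultimately show ?thesis by blast
qed

text \<open>An element normalises \<open>stab x0\<close> iff it moves \<open>x0\<close> to a point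
  with the same stabiliser, that is, to \<open>R \<gamma> x0\<close> for some
  \<open>\<gamma>\<close>. Sending it to \<open>\<gamma>\<close> gives a surjection onto
  \<open>\<Gamma>\<close> with kernel \<open>stab x0\<close>.\<close>

lemma normalizer_quotient_iso:
  fixes R :: "'g \<Rightarrow> 'x \<Rightarrow> 'x" and \<Gamma> :: "'g monoid"
  assumes kX: "\<And>i. i < n \<Longrightarrow> k i ` X = X" and x0: "x0 \<in> X"
    and trans: "\<And>x. x \<in> X \<Longrightarrow> \<exists>t\<in>carrier T. act t x0 = x"
    and \<Gamma>: "group \<Gamma>"
    and R_comm: "\<And>\<gamma> x i. \<gamma> \<in> carrier \<Gamma> \<Longrightarrow> x \<in> X \<Longrightarrow> i < n \<Longrightarrow> R \<gamma> (k i x) = k i (R \<gamma> x)"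
    and R_in: "\<And>\<gamma> x. \<gamma> \<in> carrier \<Gamma> \<Longrightarrow> x \<in> X \<Longrightarrow> R \<gamma> x \<in> X"
    and R_mult: "\<And>\<gamma> \<delta>. \<gamma> \<in> carrier \<Gamma> \<Longrightarrow> \<delta> \<in> carrier \<Gamma> \<Longrightarrow> R \<delta> (R \<gamma> x0) = R (\<gamma> \<otimes>\<^bsub>\<Gamma>\<^esub> \<delta>) x0"
    and R_one: "R \<one>\<^bsub>\<Gamma>\<^esub> x0 = x0"
    and R_inj: "\<And>\<gamma> \<delta>. \<gamma> \<in> carrier \<Gamma> \<Longrightarrow> \<delta> \<in> carrier \<Gamma> \<Longrightarrow> R \<gamma> x0 = R \<delta> x0 \<Longrightarrow> \<gamma> = \<delta>"
    and aut: "\<And>f. (\<And>x. x \<in> X \<Longrightarrow> f x \<in> X \<and> (\<forall>i<n. f (k i x) = k i (f x))) \<Longrightarrow> \<exists>\<gamma>\<in>carrier \<Gamma>. f x0 = R \<gamma> x0"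
  shows "(T\<lparr>carrier := normalizer T (stab x0)\<rparr>) Mod stab x0 \<cong> \<Gamma>"
proof -
  interpret \<Gamma>: group \<Gamma> by (rule \<Gamma>)
  let ?H = "stab x0" and ?N = "normalizer T (stab x0)"
  have Hsub: "?H \<subseteq> carrier T" by (auto simp: stab_def)
  have N: "g \<in> ?N \<longleftrightarrow> g \<in> carrier T \<and> stab (act g x0) = ?H" for g
    unfolding normalizer_eq[OF Hsub] mem_Collect_eq by (rule conj_cong[OF HOL.refl]) (simp only: stab_act)
  have R_act: "R \<gamma> (act t x) = act t (R \<gamma> x)" if "t \<in> carrier T" "\<gamma> \<in> carrier \<Gamma>" "x \<in> X" for t \<gamma> x
    using that(1)
  proof (induction t rule: T_induct)
    case (gen i t)
    then show ?case using R_comm[OF that(2) act_in[OF kX gen(2) that(3)] gen(1)] by (simp add: act_mult act_gen)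
  next
    case (inv_gen i t)
    let ?y = "act (inv (gen i)) (act t x)"
    have "?y \<in> X" using act_in[OF kX _ act_in[OF kX inv_gen(2) that(3)], of "inv (gen i)"] inv_gen(1) by simp
    moreover have "k i ?y = act t x" using inv_gen act_inv_right[of "gen i"] by (simp add: act_gen)
    ultimately have "R \<gamma> (act t x) = act (gen i) (R \<gamma> ?y)"
      using R_comm[OF that(2), of ?y i] inv_gen(1) by (simp add: act_gen)
    then show ?case using inv_gen by (simp add: act_mult)
  qed simp
  have N_iff: "g \<in> ?N \<longleftrightarrow> (\<exists>\<gamma>\<in>carrier \<Gamma>. act g x0 = R \<gamma> x0)" if g: "g \<in> carrier T" for g
  proof
    assume "g \<in> ?N"
    then have "stab x0 = stab (act g x0)" by (simp add: N)
    from equivariant_map[OF perm_action_axioms kX trans kX act_in[OF kX g x0] this]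
    obtain f where "f x0 = act g x0" "\<forall>x\<in>X. f x \<in> X \<and> (\<forall>i<n. f (k i x) = k i (f x))" by blast
    then show "\<exists>\<gamma>\<in>carrier \<Gamma>. act g x0 = R \<gamma> x0" using aut[of f] by metis
  next
    assume "\<exists>\<gamma>\<in>carrier \<Gamma>. act g x0 = R \<gamma> x0"
    then obtain \<gamma> where \<gamma>: "\<gamma> \<in> carrier \<Gamma>" "act g x0 = R \<gamma> x0" by blast
    have "t \<in> stab (R \<gamma> x0) \<longleftrightarrow> t \<in> ?H" for t
    proof -
      have "x0 = R (inv\<^bsub>\<Gamma>\<^esub> \<gamma>) (R \<gamma> x0)" using \<gamma> R_mult[of \<gamma> "inv\<^bsub>\<Gamma>\<^esub> \<gamma>"] R_one by simp
      then show ?thesis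
        using R_act[OF _ \<gamma>(1) x0, of t] R_act[OF _ \<Gamma>.inv_closed[OF \<gamma>(1)] R_in[OF \<gamma>(1) x0], of t]
        by (auto simp: stab_def)
    qed
    then show "g \<in> ?N" using \<gamma> g by (auto simp: N)
  qed
  define \<chi> where "\<chi> = (\<lambda>g. THE \<gamma>. \<gamma> \<in> carrier \<Gamma> \<and> act g x0 = R \<gamma> x0)"
  have \<chi>_eq: "\<chi> g = \<gamma>" if "\<gamma> \<in> carrier \<Gamma>" "act g x0 = R \<gamma> x0" for g \<gamma>
    unfolding \<chi>_def using that R_inj by (intro the_equality) auto
  have \<chi>: "\<chi> g \<in> carrier \<Gamma> \<and> act g x0 = R (\<chi> g) x0" if "g \<in> ?N" for g
    using that N_iff[of g] N[of g] \<chi>_eq by auto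
  have Nsub: "subgroup ?N T" using normalizer_imp_subgroup[OF Hsub] .
  interpret N: group "T\<lparr>carrier := ?N\<rparr>" using subgroup.subgroup_is_group[OF Nsub group_T] .
  have hom: "\<chi> \<in> hom (T\<lparr>carrier := ?N\<rparr>) \<Gamma>"
  proof (rule homI)
    fix g h assume gh: "g \<in> carrier (T\<lparr>carrier := ?N\<rparr>)" "h \<in> carrier (T\<lparr>carrier := ?N\<rparr>)"
    then have c: "g \<in> carrier T" "h \<in> carrier T" by (auto simp: N)
    \<comment> \<open>\<open>R\<close> commutes with \<open>act\<close> and composes in reversed
      order, as a right action; the two reversals make \<open>\<chi>\<close> a homomorphism.\<close>
    have "act (g \<otimes> h) x0 = R (\<chi> h) (act g x0)"
      using \<chi>[of h] gh c R_act[OF c(1) _ x0] by (simp add: act_mult)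
    also have "\<dots> = R (\<chi> g \<otimes>\<^bsub>\<Gamma>\<^esub> \<chi> h) x0" using \<chi>[of g] \<chi>[of h] gh R_mult by simp
    finally show "\<chi> (g \<otimes>\<^bsub>T\<lparr>carrier := ?N\<rparr>\<^esub> h) = \<chi> g \<otimes>\<^bsub>\<Gamma>\<^esub> \<chi> h"
      using \<chi>[of g] \<chi>[of h] gh \<chi>_eq by simp
  qed (use \<chi> in simp)
  interpret \<chi>: group_hom "T\<lparr>carrier := ?N\<rparr>" \<Gamma> \<chi>
    using hom by unfold_locales
  have "\<chi> ` carrier (T\<lparr>carrier := ?N\<rparr>) = carrier \<Gamma>"
  proof
    show "carrier \<Gamma> \<subseteq> \<chi> ` carrier (T\<lparr>carrier := ?N\<rparr>)"
    proof
      fix \<gamma> assume \<gamma>: "\<gamma> \<in> carrier \<Gamma>"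
      obtain g where g: "g \<in> carrier T" "act g x0 = R \<gamma> x0" using trans[OF R_in[OF \<gamma> x0]] by blast
      then have "g \<in> ?N" using N_iff \<gamma> by blast
      then show "\<gamma> \<in> \<chi> ` carrier (T\<lparr>carrier := ?N\<rparr>)" using \<chi>_eq[OF \<gamma> g(2)] by force
    qed
  qed (use \<chi> in auto)
  moreover have "kernel (T\<lparr>carrier := ?N\<rparr>) \<Gamma> \<chi> = ?H"
  proof -
    have "g \<in> ?N \<and> \<chi> g = \<one>\<^bsub>\<Gamma>\<^esub> \<longleftrightarrow> g \<in> ?H" for g
    proof
      assume "g \<in> ?N \<and> \<chi> g = \<one>\<^bsub>\<Gamma>\<^esub>"
      then have "g \<in> carrier T" "act g x0 = x0" using \<chi>[of g] R_one N[of g] by auto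
      then show "g \<in> ?H" by (simp add: stab_def)
    next
      assume "g \<in> ?H"
      then have "g \<in> carrier T" "act g x0 = x0" by (simp_all add: stab_def)
      then show "g \<in> ?N \<and> \<chi> g = \<one>\<^bsub>\<Gamma>\<^esub>" using \<chi>_eq[of "\<one>\<^bsub>\<Gamma>\<^esub>" g] R_one by (simp add: N)
    qed
    then show ?thesis by (auto simp: kernel_def)
  qed
  ultimately show ?thesis using \<chi>.FactGroup_iso by simp
qed

end

section \<open>A family of permutation representations\<close>

lemma bij_if_funpow_id:
  assumes "f ^^ m = id" "0 < m"
  shows "bij f"
proof (rule o_bij)
  have "f ^^ Suc (m - 1) = id" using assms by simp
  then show "f ^^ (m - 1) \<circ> f = id" "f \<circ> f ^^ (m - 1) = id"
    by (simp_all only: funpow_Suc_right[symmetric] funpow.simps(2)[symmetric])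
qed

lemma permutes_if_funpow_id:
  assumes "f ^^ m = id" "0 < m" "\<And>x. x \<notin> A \<Longrightarrow> f x = x"
  shows "f permutes A"
  using bij_if_funpow_id[OF assms(1,2)] assms(3) unfolding permutes_def bij_iff by blast

text \<open>\<open>l\<close> is the last generator and \<open>q\<close> its cycle length; the others
  act on the rows \<open>A\<close> by \<open>s\<close>, and the word \<open>rs\<close> gives the row
  rotation. \<open>rot_free\<close> and \<open>rot_rot\<close> keep three rows apart. Surjectivity
  of the labelling \<open>v\<close> of the copies makes every sheet reachable.\<close>

locale permutation_family = cyclic_free_product n p T + Q: group \<Gamma>
  for n p T and \<Gamma> :: "'g monoid" +
  fixes l q :: nat and A :: "'a set" and s :: "nat \<Rightarrow> 'a \<Rightarrow> 'a" and a0 :: 'a and rs :: "nat list"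
    and M :: nat and v :: "nat \<Rightarrow> 'g"
  assumes l: "l < n" and q: "2 \<le> q" and p_l: "\<And>m. p l = enat m \<Longrightarrow> m = q"
    and finA: "finite A" and a0: "a0 \<in> A"
    and s_perm: "\<And>i. i < n \<Longrightarrow> i \<noteq> l \<Longrightarrow> s i permutes A"
    and s_order: "\<And>i m. i < n \<Longrightarrow> i \<noteq> l \<Longrightarrow> p i = enat m \<Longrightarrow> s i ^^ m = id"
    and s_free: "\<And>i m a j. i < n \<Longrightarrow> i \<noteq> l \<Longrightarrow> p i = enat m \<Longrightarrow> a \<in> A \<Longrightarrow> 0 < j \<Longrightarrow> j < m \<Longrightarrow>
      (s i ^^ j) a \<noteq> a"
    and s_trans: "\<And>a b. a \<in> A \<Longrightarrow> b \<in> A \<Longrightarrow> \<exists>is\<in>lists ({..<n} - {l}). foldr s is a = b"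
    and rs: "rs \<in> lists ({..<n} - {l})"
    and rot_free: "\<And>a. a \<in> A \<Longrightarrow> foldr s rs a \<noteq> a"
    and rot_rot: "foldr s rs (foldr s rs a0) \<noteq> a0"
    and fin\<Gamma>: "finite (carrier \<Gamma>)" and M: "1 \<le> M"
    and v: "v ` {1..M} = carrier \<Gamma>" and v_out: "\<And>j. j \<notin> {1..M} \<Longrightarrow> v j = \<one>\<^bsub>\<Gamma>\<^esub>"
begin

abbreviation rot :: "'a \<Rightarrow> 'a" where "rot \<equiv> foldr s rs"

definition a1 :: 'a where "a1 = rot a0"
definition a2 :: 'a where "a2 = rot a1"

abbreviation \<alpha> :: "'a \<times> nat \<times> nat" where "\<alpha> \<equiv> (a0, 1, 0)"
abbreviation \<beta> :: "'a \<times> nat \<times> nat" where "\<beta> \<equiv> (a1, 0, 0)"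
abbreviation \<zeta> :: "'a \<times> nat \<times> nat" where "\<zeta> \<equiv> (a1, 1, 1)"

text \<open>The column shift sends \<open>z0\<close> to \<open>\<alpha>\<close>, which this cycle
  sends on to \<open>\<beta>\<close>, the rotation of \<open>z0\<close>. The point
  \<open>\<zeta>\<close> lies in copy 1 and attaches copy 0 to the others.\<close>

definition cycle3 :: "'a \<times> nat \<times> nat \<Rightarrow> 'a \<times> nat \<times> nat" where
  "cycle3 = transpose \<alpha> \<zeta> \<circ> transpose \<alpha> \<beta>"

text \<open>Copy 0, which holds the marked points, is kept out of the cyclic order.\<close>

definition succ :: "nat \<Rightarrow> nat" where
  "succ j = (if j \<in> {1..M} then if j = M then 1 else Suc j else j)"

text \<open>The identity off the carrier makes this a bijection of the whole type, as
  \<open>Perm\<close> requires; \<open>shift\<close> is extended likewise.\<close>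

definition lmult :: "'g \<Rightarrow> 'g \<Rightarrow> 'g" where
  "lmult g h = (if h \<in> carrier \<Gamma> then g \<otimes>\<^bsub>\<Gamma>\<^esub> h else h)"

text \<open>Only column 0 is altered, so most steps of the last generator do not meet the links. The
  sheet changes by left multiplication, which leaves the right multiplications as
  automorphisms.\<close>

definition link :: "(nat \<Rightarrow> nat) \<Rightarrow> ('a \<times> nat \<times> nat) \<times> 'g \<Rightarrow> ('a \<times> nat \<times> nat) \<times> 'g" where
  "link \<pi> = (\<lambda>((a, b, j), g). if b = 0 \<and> a = a0 then ((a, b, succ j), g)
     else if b = 0 \<and> a = a1 then ((a, b, \<pi> j), lmult (v j) g) else ((a, b, j), g))"

definition glue :: "(nat \<Rightarrow> nat) \<Rightarrow> ('a \<times> nat \<times> nat) \<times> 'g \<Rightarrow> ('a \<times> nat \<times> nat) \<times> 'g" where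
  "glue \<pi> = map_prod cycle3 id \<circ> link \<pi>"

definition shift :: "('a \<times> nat \<times> nat) \<times> 'g \<Rightarrow> ('a \<times> nat \<times> nat) \<times> 'g" where
  "shift = (\<lambda>((a, b, j), g). ((a, if b < q then Suc b mod q else b, j), g))"

definition K :: "(nat \<Rightarrow> nat) \<Rightarrow> nat \<Rightarrow> ('a \<times> nat \<times> nat) \<times> 'g \<Rightarrow> ('a \<times> nat \<times> nat) \<times> 'g" where
  "K \<pi> i = (if i = l then glue \<pi> \<circ> shift \<circ> inv_into UNIV (glue \<pi>)
     else map_prod (map_prod (s i) id) id)"

definition Z :: "('a \<times> nat \<times> nat) set" where
  "Z = A \<times> {..<q} \<times> {..M}"

definition X :: "(('a \<times> nat \<times> nat) \<times> 'g) set" where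
  "X = Z \<times> carrier \<Gamma>"

abbreviation z0 :: "'a \<times> nat \<times> nat" where "z0 \<equiv> (a0, 0, 0)"

abbreviation x0 :: "('a \<times> nat \<times> nat) \<times> 'g" where "x0 \<equiv> (z0, \<one>\<^bsub>\<Gamma>\<^esub>)"

lemma s_in: "i < n \<Longrightarrow> i \<noteq> l \<Longrightarrow> s i a \<in> A \<longleftrightarrow> a \<in> A"
  by (rule permutes_in_image[OF s_perm])

lemma foldr_s_in: "is \<in> lists ({..<n} - {l}) \<Longrightarrow> foldr s is a \<in> A \<longleftrightarrow> a \<in> A"
  by (induction "is") (auto simp: s_in)

lemma rows: "a1 \<in> A" "a2 \<in> A" "a0 \<noteq> a1" "a1 \<noteq> a0" "a1 \<noteq> a2" "a2 \<noteq> a1" "a0 \<noteq> a2" "a2 \<noteq> a0"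
  using a0 foldr_s_in[OF rs] rot_free[OF a0] rot_free[of a1] rot_rot by (auto simp: a1_def a2_def)

lemma cycle3: "cycle3 z = (if z = \<alpha> then \<beta> else if z = \<beta> then \<zeta> else if z = \<zeta> then \<alpha> else z)"
  using rows by (auto simp: cycle3_def transpose_def)

lemma bij_cycle3: "bij cycle3"
  unfolding cycle3_def by (rule bij_comp[OF bij_transpose bij_transpose])

lemma succ_permutes: "succ permutes {1..M}"
proof (rule bij_imp_permutes)
  have inj: "inj_on succ {1..M}"
  proof (rule inj_onI)
    fix i j assume ij: "i \<in> {1..M}" "j \<in> {1..M}" and eq: "succ i = succ j"
    have "succ i = (if i = M then 1 else Suc i)" "succ j = (if j = M then 1 else Suc j)"
      unfolding succ_def if_P[OF ij(1)] if_P[OF ij(2)] by blast+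
    then have "(if i = M then 1 else Suc i) = (if j = M then 1 else Suc j)" using eq by metis
    moreover have "1 \<le> i" "1 \<le> j" using ij unfolding atLeastAtMost_iff by blast+
    ultimately show "i = j" by presburger
  qed
  have "succ ` {1..M} \<subseteq> {1..M}"
  proof (rule image_subsetI)
    fix j assume "j \<in> {1..M}"
    then show "succ j \<in> {1..M}" unfolding succ_def by simp
  qed
  then show "bij_betw succ {1..M} {1..M}"
    unfolding bij_betw_def using inj endo_inj_surj by blast
  show "succ j = j" if "j \<notin> {1..M}" for j
    unfolding succ_def if_not_P[OF that] ..
qed

lemma v_in: "v j \<in> carrier \<Gamma>"
  using v v_out by (cases "j \<in> {1..M}") auto

lemma lmult_in: "g \<in> carrier \<Gamma> \<Longrightarrow> lmult g h \<in> carrier \<Gamma> \<longleftrightarrow> h \<in> carrier \<Gamma>"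
  by (simp add: lmult_def)

lemma lmult_inverse:
  "g \<in> carrier \<Gamma> \<Longrightarrow> lmult (inv\<^bsub>\<Gamma>\<^esub> g) (lmult g h) = h"
  "g \<in> carrier \<Gamma> \<Longrightarrow> lmult g (lmult (inv\<^bsub>\<Gamma>\<^esub> g) h) = h"
  by (simp_all add: lmult_def Q.m_assoc[symmetric])

context
  fixes \<pi> :: "nat \<Rightarrow> nat"
  assumes \<pi>: "\<pi> permutes {1..M}"
begin

lemma bij_link: "bij (link \<pi>)"
proof (rule o_bij)
  let ?g = "\<lambda>((a, b, j), g). if b = 0 \<and> a = a0 then ((a, b, inv_into UNIV succ j), g)
     else if b = 0 \<and> a = a1 then ((a, b, inv_into UNIV \<pi> j), lmult (inv\<^bsub>\<Gamma>\<^esub> (v (inv_into UNIV \<pi> j))) g) else ((a, b, j), g)"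
  show "?g \<circ> link \<pi> = id" "link \<pi> \<circ> ?g = id"
    using rows permutes_inverses[OF \<pi>] permutes_inverses[OF succ_permutes]
    by (auto simp: fun_eq_iff link_def lmult_inverse v_in)
qed

lemma bij_glue: "bij (glue \<pi>)"
proof -
  have "bij (map_prod cycle3 (id :: 'g \<Rightarrow> 'g))"
    using bij_betw_map_prod[OF bij_cycle3, of id UNIV UNIV] by simp
  then show ?thesis unfolding glue_def using bij_link by (rule bij_comp[rotated])
qed

lemma K_glue: "K \<pi> l (glue \<pi> u) = glue \<pi> (shift u)"
  using bij_glue by (simp add: K_def inv_f_f bij_is_inj)

end

lemma shift_pow: "b < q \<Longrightarrow> (shift ^^ m) ((a, b, j), g) = ((a, (b + m) mod q, j), g)"
  using q by (induction m) (auto simp: shift_def mod_Suc)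

lemma shift_order: "shift ^^ q = id"
proof
  fix x :: "('a \<times> nat \<times> nat) \<times> 'g"
  obtain a b j g where x: "x = ((a, b, j), g)" by (cases x) auto
  have "(shift ^^ m) ((a, b, j), g) = ((a, b, j), g)" if "\<not> b < q" for m
    using that by (induction m) (auto simp: shift_def)
  then show "(shift ^^ q) x = id x" by (cases "b < q") (auto simp: x shift_pow)
qed

lemma bij_shift: "bij shift"
  using bij_if_funpow_id[OF shift_order] q by simp

lemma finite_X: "finite X"
  using finA fin\<Gamma> by (simp add: X_def Z_def)

lemma card_X: "card X = card A * q * Suc M * card (carrier \<Gamma>)"
  by (simp add: X_def Z_def card_cartesian_product algebra_simps)

lemma image_X:
  assumes "bij f" "\<And>x. x \<in> X \<Longrightarrow> f x \<in> X"
  shows "f ` X = X"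
  using assms finite_X by (intro endo_inj_surj) (auto simp: bij_def intro: inj_on_subset)

lemma cycle3_in: "z \<in> Z \<Longrightarrow> cycle3 z \<in> Z"
  using a0 rows q M by (auto simp: cycle3 Z_def)

lemma glue_in:
  assumes \<pi>: "\<pi> permutes {1..M}" and "x \<in> X"
  shows "glue \<pi> x \<in> X"
proof -
  have le: "\<sigma> j \<le> M" if "\<sigma> permutes {1..M}" "j \<le> M" for \<sigma> j
    using permutes_in_image[OF that(1), of j] permutes_not_in[OF that(1), of j] that(2) by (cases "j = 0") auto
  obtain a b j g where x: "x = ((a, b, j), g)" by (cases x) auto
  have mem: "a \<in> A" "b < q" "j \<le> M" "g \<in> carrier \<Gamma>" using assms(2) by (auto simp: x X_def Z_def)
  have "\<pi> j \<le> M" "succ j \<le> M" using le \<pi> succ_permutes mem(3) by blast+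
  then have "link \<pi> x \<in> X" using mem rows a0 by (simp add: x link_def X_def Z_def lmult_in v_in)
  then show ?thesis using cycle3_in by (auto simp: glue_def X_def)
qed

lemma shift_in: "x \<in> X \<Longrightarrow> shift x \<in> X"
  using q by (auto simp: shift_def X_def Z_def)

lemma K_image:
  assumes \<pi>: "\<pi> permutes {1..M}" and "i < n"
  shows "K \<pi> i ` X = X"
proof (cases "i = l")
  case True
  have g: "glue \<pi> ` X = X" using image_X[OF bij_glue[OF \<pi>]] glue_in[OF \<pi>] by blast
  have "inv_into UNIV (glue \<pi>) ` X = X"
    by (subst (1) g[symmetric]) (simp add: image_image inv_f_f bij_is_inj bij_glue[OF \<pi>])
  moreover have "shift ` X = X" using image_X[OF bij_shift] shift_in by blast
  ultimately show ?thesis unfolding K_def if_P[OF True] image_comp[symmetric] by (simp only: g)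
next
  case False
  have "s i ` A = A" using s_perm[OF assms(2) False] by (rule permutes_image)
  then have "map_prod (s i) id ` Z = Z" unfolding Z_def by (simp add: map_prod_surj_on)
  then show ?thesis using False unfolding K_def X_def by (simp add: map_prod_surj_on)
qed

lemma perm_action_K:
  assumes \<pi>: "\<pi> permutes {1..M}"
  shows "perm_action n p T (K \<pi>)"
proof
  show "bij (K \<pi> i)" if "i < n" for i
  proof (cases "i = l")
    case True
    then show ?thesis using bij_glue[OF \<pi>] bij_shift by (auto simp: K_def bij_comp bij_imp_bij_inv)
  next
    case False
    have "bij (s i)" using s_perm[OF that False] by (rule permutes_bij)
    then have "bij (map_prod (s i) (id :: nat \<times> nat \<Rightarrow> _))"
      using bij_betw_map_prod[of "s i" UNIV UNIV id UNIV UNIV] by simp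
    then show ?thesis using False bij_betw_map_prod[of _ UNIV UNIV id UNIV UNIV] by (simp add: K_def)
  qed
  show "K \<pi> i ^^ m = id" if "i < n" "p i = enat m" for i m
  proof (cases "i = l")
    case True
    then have "m = q" using p_l that by simp
    then show ?thesis using True bij_glue[OF \<pi>]
      by (simp add: K_def funpow_conj shift_order) (simp add: fun_eq_iff surj_f_inv_f bij_is_surj)
  next
    case False
    then show ?thesis using s_order[OF that(1) False that(2)]
      by (simp add: K_def funpow_map_prod_id map_prod.id)
  qed
qed

lemma K_free:
  assumes \<pi>: "\<pi> permutes {1..M}" and "i < n" "p i = enat m" "x \<in> X" "0 < j" "j < m"
  shows "(K \<pi> i ^^ j) x \<noteq> x"
proof (cases "i = l")
  case True
  then have m: "m = q" using p_l assms by simp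
  have "x \<in> glue \<pi> ` X" using image_X[OF bij_glue[OF \<pi>]] glue_in[OF \<pi>] assms(4) by blast
  then obtain u where u: "u \<in> X" "x = glue \<pi> u" by blast
  then obtain a b i' g where ub: "u = ((a, b, i'), g)" "b < q" by (auto simp: X_def Z_def)
  have "(b + j) mod q \<noteq> b"
  proof (cases "b + j < q")
    case False
    then have "(b + j) mod q = b + j - q" using ub assms m by (simp add: le_mod_geq)
    then show ?thesis using ub assms m False by linarith
  qed (use assms in simp)
  then have "(shift ^^ j) u \<noteq> u" using ub by (simp add: shift_pow)
  moreover have "(K \<pi> i ^^ j) x = glue \<pi> ((shift ^^ j) u)"
    using True bij_glue[OF \<pi>] u by (simp add: K_def funpow_conj inv_f_f bij_is_inj)
  ultimately show ?thesis using bij_glue[OF \<pi>] u by (simp add: bij_def inj_eq)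
next
  case False
  obtain a y g where x: "x = ((a, y), g)" "a \<in> A" using assms(4) by (cases x) (auto simp: X_def Z_def)
  show ?thesis using s_free[OF assms(2) False assms(3) x(2) assms(5,6)] False x
    by (simp add: K_def funpow_map_prod_id)
qed

lemma foldr_K:
  "is \<in> lists ({..<n} - {l}) \<Longrightarrow> foldr (K \<pi>) is ((a, y), g) = ((foldr s is a, y), g)"
proof (induction "is")
  case (Cons i "is")
  then show ?case by (auto simp: K_def)
qed simp

context
  fixes \<pi> :: "nat \<Rightarrow> nat"
  assumes \<pi>: "\<pi> permutes {1..M}"
begin

lemma K_row: "b < q \<Longrightarrow> K \<pi> l ((a2, b, j), g) = ((a2, Suc b mod q, j), g)"
  using K_glue[OF \<pi>, of "((a2, b, j), g)"] rows by (simp add: glue_def link_def cycle3 shift_def)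

lemma K_chain: "j \<in> {1..M} \<Longrightarrow> K \<pi> l ((a0, q - 1, j), g) = ((a0, 0, succ j), g)"
  using K_glue[OF \<pi>, of "((a0, q - 1, j), g)"] rows q
  by (simp add: glue_def link_def cycle3 shift_def)

lemma K_start: "K \<pi> l ((a1, q - 1, 0), g) = (\<zeta>, g)"
proof -
  have "\<pi> 0 = 0" using \<pi> by (simp add: permutes_not_in)
  then show ?thesis
    using K_glue[OF \<pi>, of "((a1, q - 1, 0), g)"] rows q v_out[of 0]
    by (simp add: glue_def link_def cycle3 shift_def lmult_def)
qed

text \<open>For \<open>q = 2\<close> and \<open>j = 1\<close> the point
  \<open>(a1, q - 1, j)\<close> is \<open>\<zeta>\<close> and is moved by the three-cycle; hence
  \<open>cycle3\<close> in the argument.\<close>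

lemma K_\<pi>:
  assumes "j \<in> {1..M}" "g \<in> carrier \<Gamma>"
  shows "K \<pi> l (cycle3 (a1, q - 1, j), g) = ((a1, 0, \<pi> j), v j \<otimes>\<^bsub>\<Gamma>\<^esub> g)"
proof -
  have "\<pi> j \<in> {1..M}" using assms(1) permutes_in_image[OF \<pi>] by blast
  then show ?thesis
    using K_glue[OF \<pi>, of "((a1, q - 1, j), g)"] rows q assms
    by (simp add: glue_def link_def cycle3 shift_def lmult_def)
qed

text \<open>Links preserve rows, so that the rotation and the last generator can only agree where the
  three-cycle interferes.\<close>

lemma K_eq_rot_iff:
  assumes "x \<in> X"
  shows "K \<pi> l x = foldr (K \<pi>) rs x \<longleftrightarrow> fst x = z0"
proof -
  have "x \<in> glue \<pi> ` X" using image_X[OF bij_glue[OF \<pi>]] glue_in[OF \<pi>] assms by blast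
  then obtain u where u: "u \<in> X" "x = glue \<pi> u" by blast
  then obtain a b j g where ub: "u = ((a, b, j), g)" "a \<in> A" "b < q" "j \<le> M" "g \<in> carrier \<Gamma>"
    by (auto simp: X_def Z_def)
  have \<pi>0: "\<pi> 0 = 0" "v 0 = \<one>\<^bsub>\<Gamma>\<^esub>" "succ 0 = 0"
    using \<pi> v_out[of 0] by (simp_all add: permutes_not_in succ_def)
  \<comment> \<open>The links do not mix copy 0 with the other copies, so \<open>j1\<close> and
    \<open>j2\<close> below vanish together.\<close>
  have \<pi>1: "\<pi> i = 0 \<longleftrightarrow> i = 0" "succ i = 0 \<longleftrightarrow> i = 0" for i
    using \<pi>0 permutes_inj[OF \<pi>] permutes_inj[OF succ_permutes] by (metis injD)+
  define b' where "b' = Suc b mod q"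
  have b': "b' \<noteq> b" "b' = 1 \<longleftrightarrow> b = 0" using ub q by (auto simp: b'_def mod_Suc)
  obtain y h where y: "link \<pi> u = (y, h)" by (cases "link \<pi> u") blast
  obtain y' h' where y': "link \<pi> (shift u) = (y', h')" by (cases "link \<pi> (shift u)") blast
  obtain j1 where j1: "y = (a, b, j1)" "j1 = 0 \<longleftrightarrow> j = 0" "b \<noteq> 0 \<Longrightarrow> j1 = j" "b = 0 \<and> a = a0 \<Longrightarrow> h = g"
    using y ub \<pi>0 \<pi>1 by (cases "b = 0"; cases "a = a0"; cases "a = a1") (auto simp: link_def)
  obtain j2 where j2: "y' = (a, b', j2)" "j2 = 0 \<longleftrightarrow> j = 0" "b' \<noteq> 0 \<Longrightarrow> j2 = j \<and> h' = g"
    using y' ub \<pi>0 \<pi>1 by (cases "b' = 0"; cases "a = a0"; cases "a = a1") (auto simp: link_def shift_def b'_def)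
  have x: "x = (cycle3 y, h)" using u y by (simp add: glue_def)
  have Kx: "K \<pi> l x = (cycle3 y', h')" using u y' K_glue[OF \<pi>] by (simp add: glue_def)
  have rx: "foldr (K \<pi>) rs x = ((rot (fst (cycle3 y)), snd (cycle3 y)), h)"
    unfolding x by (subst prod.collapse[symmetric, of "cycle3 y"], subst foldr_K[OF rs]) simp
  have r1: "rot a0 = a1" "rot a1 = a2" by (simp_all add: a1_def a2_def)
  have eq_iff: "K \<pi> l x = foldr (K \<pi>) rs x \<longleftrightarrow>
      fst (cycle3 y') = rot (fst (cycle3 y)) \<and> snd (cycle3 y') = snd (cycle3 y) \<and> h' = h"
    unfolding Kx rx by (auto simp: prod_eq_iff)
  show ?thesis
  proof
    assume eq: "K \<pi> l x = foldr (K \<pi>) rs x"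
    then have e1: "fst (cycle3 y') = rot (fst (cycle3 y))" and e2: "snd (cycle3 y') = snd (cycle3 y)"
      using eq_iff by blast+
    \<comment> \<open>\<open>y\<close> and \<open>y'\<close> lie in one row and in different
      columns. If \<open>y\<close> is one of the three moved points, a comparison of rows or columns
      refutes agreement. Otherwise only the three-cycle can change the row as the rotation does,
      which forces \<open>y' = \<alpha>\<close>.\<close>
    consider "y = \<alpha>" | "y = \<beta>" | "y = \<zeta>" | "y \<notin> {\<alpha>, \<beta>, \<zeta>}" by blast
    then show "fst x = z0"
    proof cases
      case 1
      then have "fst (cycle3 y') = a0" using j1 j2 b' rows by (auto simp: cycle3)
      moreover have "cycle3 y = \<beta>" using 1 by (simp add: cycle3)
      ultimately show ?thesis using e1 rows r1 by simp
    next
      case 2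
      then have "fst (cycle3 y') \<noteq> a2" using j1 j2 rows by (auto simp: cycle3)
      moreover have "cycle3 y = \<zeta>" using 2 rows by (simp add: cycle3)
      ultimately show ?thesis using e1 r1 by simp
    next
      case 3
      then have "snd (cycle3 y') \<noteq> (1, 0)" using j1 j2 b' rows by (auto simp: cycle3)
      moreover have "cycle3 y = \<alpha>" using 3 rows by (simp add: cycle3)
      ultimately show ?thesis using e2 by simp
    next
      case 4
      then have cy: "cycle3 y = y" by (simp add: cycle3)
      then have rot_a: "fst (cycle3 y') = rot a" using e1 j1 by simp
      have "y' = \<alpha>"
      proof (rule ccontr)
        assume "y' \<noteq> \<alpha>"
        then have "a = a1 \<and> fst (cycle3 y') \<in> {a1, a0} \<or> fst (cycle3 y') = a"
          using j2 by (auto simp: cycle3)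
        then show False using rot_a rot_free[OF ub(2)] rows r1 by auto
      qed
      then have "y = z0" using j1 j2 b' by auto
      then show ?thesis using cy by (simp add: x)
    qed
  next
    assume "fst x = z0"
    then have "y = z0" using rows by (auto simp: x cycle3 split: if_splits)
    then have "y' = \<alpha>" "h' = h" using j1 j2 b' by auto
    then show "K \<pi> l x = foldr (K \<pi>) rs x" using \<open>y = z0\<close> rows r1 by (simp add: eq_iff cycle3)
  qed
qed

end

section \<open>Connectedness and equivariant maps\<close>

text \<open>These moves stay in one sheet and are the same for every permutation of the copies, yet
  they reach all of \<open>Z\<close>. They serve both for transitivity and for showing that an
  equivariant map is determined on a sheet by its marked point.\<close>

lemma Z_induct [consumes 1, case_names base row col chain start]:
  assumes z: "z \<in> Z" and base: "P z0"
    and row: "\<And>a b j i. (a, b, j) \<in> Z \<Longrightarrow> i < n \<Longrightarrow> i \<noteq> l \<Longrightarrow> P (a, b, j) \<Longrightarrow> P (s i a, b, j)"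
    and col: "\<And>b j. b < q \<Longrightarrow> j \<le> M \<Longrightarrow> P (a2, b, j) \<Longrightarrow> P (a2, Suc b mod q, j)"
    and chain: "\<And>j. j \<in> {1..M} \<Longrightarrow> P (a0, q - 1, j) \<Longrightarrow> P (a0, 0, succ j)"
    and start: "P (a1, q - 1, 0) \<Longrightarrow> P \<zeta>"
  shows "P z"
proof -
  have rows': "P (a', b, j)" if "a \<in> A" "a' \<in> A" "b < q" "j \<le> M" "P (a, b, j)" for a a' b j
  proof -
    have step: "P (foldr s is a, b, j)" if "is \<in> lists ({..<n} - {l})" for "is"
      using that
    proof (induction "is" rule: list.induct)
      case (Cons i "is")
      then have "is \<in> lists ({..<n} - {l})" "i < n" "i \<noteq> l" by auto
      moreover have "(foldr s is a, b, j) \<in> Z"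
        using \<open>a \<in> A\<close> \<open>b < q\<close> \<open>j \<le> M\<close> foldr_s_in calculation(1) by (simp add: Z_def)
      ultimately show ?case using row Cons.IH by simp
    qed (use \<open>P (a, b, j)\<close> in simp)
    obtain "is" where "is \<in> lists ({..<n} - {l})" "foldr s is a = a'" using s_trans[OF \<open>a \<in> A\<close> \<open>a' \<in> A\<close>] by blast
    then show ?thesis using step by blast
  qed
  have copy: "P (a', b', j)" if "a \<in> A" "a' \<in> A" "b < q" "b' < q" "j \<le> M" "P (a, b, j)" for a a' b b' j
  proof -
    have "P (a2, (b + m) mod q, j)" for m
    proof (induction m)
      case 0
      then show ?case using rows'[of a a2 b j] rows that by simp
    next
      case (Suc m)
      then show ?case using col[of "(b + m) mod q" j] that by (simp add: mod_Suc_eq)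
    qed
    from this[of "q - b + b'"] have "P (a2, b', j)" using that by simp
    then show ?thesis using rows'[of a2 a' b' j] rows that by blast
  qed
  \<comment> \<open>Copy 0 leads to copy 1 by \<open>start\<close>, and copy \<open>j\<close> to
    copy \<open>j + 1\<close> by \<open>chain\<close>.\<close>
  have copies: "\<forall>a\<in>A. \<forall>b<q. P (a, b, j)" if "j \<le> M" for j
    using that
  proof (induction j)
    case 0
    then show ?case using copy[of a0 _ 0 _ 0] base a0 q by simp
  next
    case (Suc j)
    have "\<exists>a\<in>A. \<exists>b<q. P (a, b, Suc j)"
    proof (cases "j = 0")
      case True
      have "P (a1, q - 1, 0)" using Suc.IH Suc.prems rows q True by simp
      then have "P \<zeta>" by (rule start)
      then show ?thesis using True rows q by force
    next
      case False
      then have j: "j \<in> {1..M}" "succ j = Suc j" using Suc.prems by (auto simp: succ_def)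
      have "P (a0, q - 1, j)" using Suc.IH Suc.prems a0 q by simp
      then have "P (a0, 0, Suc j)" using chain[OF j(1)] j(2) by simp
      then show ?thesis using a0 q by force
    qed
    then show ?case using copy Suc.prems by blast
  qed
  then show ?thesis using z by (auto simp: Z_def)
qed

lemma K_other: "i \<noteq> l \<Longrightarrow> K \<pi> i ((a, y), g) = ((s i a, y), g)"
  by (simp add: K_def)

lemma cycle3_last_in: "j \<le> M \<Longrightarrow> cycle3 (a1, q - 1, j) \<in> Z"
  using rows q by (intro cycle3_in) (simp add: Z_def)

lemma x0_in: "x0 \<in> X"
  using a0 q by (simp add: X_def Z_def)

text \<open>Right multiplication on the sheets commutes with \<open>lmult\<close>; these maps are
  the automorphisms that realise \<open>\<Gamma>\<close>.\<close>

definition translate :: "'g \<Rightarrow> ('a \<times> nat \<times> nat) \<times> 'g \<Rightarrow> ('a \<times> nat \<times> nat) \<times> 'g" where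
  "translate g x = (fst x, snd x \<otimes>\<^bsub>\<Gamma>\<^esub> g)"

lemma translate_in: "g \<in> carrier \<Gamma> \<Longrightarrow> x \<in> X \<Longrightarrow> translate g x \<in> X"
  by (auto simp: translate_def X_def)

lemma translate_K:
  assumes \<pi>: "\<pi> permutes {1..M}" and g: "g \<in> carrier \<Gamma>" and x: "x \<in> X"
  shows "translate g (K \<pi> i x) = K \<pi> i (translate g x)"
proof (cases "i = l")
  case True
  have "x \<in> glue \<pi> ` X" using image_X[OF bij_glue[OF \<pi>]] glue_in[OF \<pi>] x by blast
  then obtain u where u: "u \<in> X" "x = glue \<pi> u" by blast
  have glue: "translate g (glue \<pi> w) = glue \<pi> (translate g w)" if "w \<in> X" for w
  proof -
    obtain a b j h where w: "w = ((a, b, j), h)" by (cases w) auto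
    have h: "h \<in> carrier \<Gamma>" using that by (simp add: w X_def)
    show ?thesis using h g v_in[of j]
      by (simp add: w glue_def link_def translate_def lmult_def Q.m_assoc)
  qed
  have "translate g (shift w) = shift (translate g w)" for w
    by (auto simp: shift_def translate_def split: prod.split)
  then show ?thesis using u glue shift_in translate_in[OF g] K_glue[OF \<pi>] True by metis
next
  case False
  then show ?thesis by (auto simp: K_def translate_def split: prod.split)
qed

text \<open>\<open>Z_induct\<close> connects each sheet internally. Row \<open>a1\<close> leads from
  the unit sheet to any sheet \<open>g\<close>, through a copy \<open>j\<close> with
  \<open>v j = g\<close>.\<close>

lemma K_transitive:
  assumes \<pi>: "\<pi> permutes {1..M}" and x: "x \<in> X"
  shows "\<exists>t\<in>carrier T. perm_action.act n p T (K \<pi>) t x0 = x"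
proof -
  interpret act: perm_action n p T "K \<pi>" by (rule perm_action_K[OF \<pi>])
  have step: "\<exists>t\<in>carrier T. act.act t y = K \<pi> i w" if "i < n" "\<exists>t\<in>carrier T. act.act t y = w" for i y w
  proof -
    from that obtain t where "t \<in> carrier T" "act.act t y = w" by blast
    then show ?thesis using that(1) by (intro bexI[of _ "gen i \<otimes>\<^bsub>T\<^esub> t"]) (auto simp: act.act_mult act.act_gen)
  qed
  have sheet: "\<exists>t\<in>carrier T. act.act t (z0, g) = (z, g)" if "z \<in> Z" for g z
    using that
  proof (induction z rule: Z_induct)
    case base
    show ?case by (intro bexI[of _ "\<one>\<^bsub>T\<^esub>"]) auto
  next
    case (row a b j i)
    then show ?case using step[OF row(2) row(4)] row(3) by (simp add: K_other)
  next
    case (col b j)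
    then show ?case using step[OF l col(3)] by (simp add: K_row[OF \<pi>])
  next
    case (chain j)
    show ?case using step[OF l chain(2)] unfolding K_chain[OF \<pi> chain(1)] by blast
  next
    case start
    show ?case using step[OF l start] unfolding K_start[OF \<pi>] by blast
  qed
  obtain z g where zg: "x = (z, g)" "z \<in> Z" "g \<in> carrier \<Gamma>" using x by (auto simp: X_def)
  have "g \<in> v ` {1..M}" unfolding v by (rule zg(3))
  then obtain j where j: "j \<in> {1..M}" "g = v j" by (rule imageE)
  have \<pi>j: "\<pi> j \<in> {1..M}" unfolding permutes_in_image[OF \<pi>] by (rule j(1))
  have "\<exists>t\<in>carrier T. act.act t x0 = (cycle3 (a1, q - 1, j), \<one>\<^bsub>\<Gamma>\<^esub>)"
    by (rule sheet[OF cycle3_last_in]) (use j(1) in simp)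
  from step[OF l this] have "\<exists>t\<in>carrier T. act.act t x0 = ((a1, 0, \<pi> j), g)"
    using K_\<pi>[OF \<pi> j(1), of "\<one>\<^bsub>\<Gamma>\<^esub>"] j zg by simp
  then obtain t1 where t1: "t1 \<in> carrier T" "act.act t1 x0 = ((a1, 0, \<pi> j), g)" by blast
  have "(a1, 0, \<pi> j) \<in> Z" using rows q \<pi>j by (simp add: Z_def)
  then obtain t2 where t2: "t2 \<in> carrier T" "act.act t2 (z0, g) = ((a1, 0, \<pi> j), g)" using sheet by blast
  obtain t3 where t3: "t3 \<in> carrier T" "act.act t3 (z0, g) = x" using sheet zg by blast
  \<comment> \<open>From the arrival point the path runs back to \<open>z0\<close> within sheet
    \<open>g\<close>, then on to \<open>x\<close>.\<close>
  have "act.act (inv\<^bsub>T\<^esub> t2 \<otimes>\<^bsub>T\<^esub> t1) x0 = (z0, g)"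
    using t1 t2 by (simp add: act.act_mult act.act_inv_eq_iff)
  then have "act.act (t3 \<otimes>\<^bsub>T\<^esub> (inv\<^bsub>T\<^esub> t2 \<otimes>\<^bsub>T\<^esub> t1)) x0 = x" using t1 t2 t3 by (simp add: act.act_mult)
  then show ?thesis using t1 t2 t3 by blast
qed

text \<open>An equivariant map preserves the marked points, hence it preserves the sheets.\<close>

lemma equivariant_sheets:
  assumes \<pi>: "\<pi> permutes {1..M}" and \<pi>': "\<pi>' permutes {1..M}"
    and f: "\<And>x. x \<in> X \<Longrightarrow> f x \<in> X \<and> (\<forall>i<n. f (K \<pi> i x) = K \<pi>' i (f x))"
  shows "\<exists>\<theta>. \<forall>g\<in>carrier \<Gamma>. \<forall>z\<in>Z. \<theta> g \<in> carrier \<Gamma> \<and> f (z, g) = (z, \<theta> g)"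
proof -
  define \<theta> where "\<theta> = (\<lambda>g. snd (f (z0, g)))"
  have K_in: "K \<pi> i x \<in> X" if "i < n" "x \<in> X" for i x using K_image[OF \<pi> that(1)] that(2) by blast
  have f_word: "foldr (K \<pi>) is x \<in> X \<and> f (foldr (K \<pi>) is x) = foldr (K \<pi>') is (f x)"
    if "is \<in> lists ({..<n} - {l})" "x \<in> X" for "is" x
    using that(1) by (induction "is" rule: list.induct) (use that(2) f K_in in auto)
  have marked: "f (z0, g) = (z0, \<theta> g) \<and> \<theta> g \<in> carrier \<Gamma>" if "g \<in> carrier \<Gamma>" for g
  proof -
    have x: "(z0, g) \<in> X" using x0_in that by (simp add: X_def)
    \<comment> \<open>By \<open>K_eq_rot_iff\<close> the marked points are those where two words in
      the generators agree, a property that equivariant maps preserve.\<close>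
    then have "K \<pi> l (z0, g) = foldr (K \<pi>) rs (z0, g)" using K_eq_rot_iff[OF \<pi>] by simp
    then have "K \<pi>' l (f (z0, g)) = foldr (K \<pi>') rs (f (z0, g))"
      using f[OF x] f_word[OF rs x] l by metis
    then have "fst (f (z0, g)) = z0" using K_eq_rot_iff[OF \<pi>'] f[OF x] by blast
    then show ?thesis using f[OF x] by (auto simp: \<theta>_def X_def prod_eq_iff)
  qed
  have "f (z, g) = (z, \<theta> g)" if g: "g \<in> carrier \<Gamma>" and z: "z \<in> Z" for g z
    using z
  proof (induction z rule: Z_induct)
    case base
    show ?case using marked[OF g] by blast
  next
    case (row a b j i)
    have "f (K \<pi> i ((a, b, j), g)) = K \<pi>' i (f ((a, b, j), g))"
      using f[of "((a, b, j), g)"] row g by (simp add: X_def)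
    then show ?case using row by (simp add: K_other)
  next
    case (col b j)
    have "f (K \<pi> l ((a2, b, j), g)) = K \<pi>' l (f ((a2, b, j), g))"
      using f[of "((a2, b, j), g)"] col g l rows by (simp add: X_def Z_def)
    then show ?case using col by (simp add: K_row[OF \<pi>] K_row[OF \<pi>'])
  next
    case (chain j)
    have "f (K \<pi> l ((a0, q - 1, j), g)) = K \<pi>' l (f ((a0, q - 1, j), g))"
      using f[of "((a0, q - 1, j), g)"] chain g l a0 q by (simp add: X_def Z_def)
    then show ?case unfolding chain(2) K_chain[OF \<pi> chain(1)] K_chain[OF \<pi>' chain(1)] .
  next
    case start
    have "f (K \<pi> l ((a1, q - 1, 0), g)) = K \<pi>' l (f ((a1, q - 1, 0), g))"
      using f[of "((a1, q - 1, 0), g)"] g l rows q by (simp add: X_def Z_def)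
    then show ?case unfolding start K_start[OF \<pi>] K_start[OF \<pi>'] .
  qed
  then show ?thesis using marked by blast
qed

text \<open>\<open>f\<close> keeps the coordinate in \<open>Z\<close>, so applying it to the edges
  of \<open>K_\<pi>\<close> reads off \<open>\<pi> j\<close> on one side and \<open>\<pi>' j\<close>
  on the other.\<close>

lemma equivariant_eq:
  assumes \<pi>: "\<pi> permutes {1..M}" and \<pi>': "\<pi>' permutes {1..M}"
    and f: "\<And>x. x \<in> X \<Longrightarrow> f x \<in> X \<and> (\<forall>i<n. f (K \<pi> i x) = K \<pi>' i (f x))"
  shows "\<pi> = \<pi>'"
proof
  fix j
  show "\<pi> j = \<pi>' j"
  proof (cases "j \<in> {1..M}")
    case True
    obtain \<theta> where \<theta>: "\<And>g z. g \<in> carrier \<Gamma> \<Longrightarrow> z \<in> Z \<Longrightarrow> \<theta> g \<in> carrier \<Gamma> \<and> f (z, g) = (z, \<theta> g)"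
      using equivariant_sheets[OF \<pi> \<pi>' f] by blast
    let ?e = "cycle3 (a1, q - 1, j)"
    have e: "?e \<in> Z" using True by (intro cycle3_last_in) simp
    have \<pi>j: "\<pi> j \<in> {1..M}" using True permutes_in_image[OF \<pi>] by blast
    then have z: "(a1, 0, \<pi> j) \<in> Z" using rows q by (simp add: Z_def)
    have "f (K \<pi> l (?e, \<one>\<^bsub>\<Gamma>\<^esub>)) = K \<pi>' l (f (?e, \<one>\<^bsub>\<Gamma>\<^esub>))"
      using f[of "(?e, \<one>\<^bsub>\<Gamma>\<^esub>)"] e l by (simp add: X_def)
    then have "f ((a1, 0, \<pi> j), v j) = K \<pi>' l (?e, \<theta> \<one>\<^bsub>\<Gamma>\<^esub>)"
      using K_\<pi>[OF \<pi> True, of "\<one>\<^bsub>\<Gamma>\<^esub>"] \<theta>[OF _ e, of "\<one>\<^bsub>\<Gamma>\<^esub>"] v_in[of j] by simp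
    then show ?thesis
      using \<theta>[OF v_in z] K_\<pi>[OF \<pi>' True, of "\<theta> \<one>\<^bsub>\<Gamma>\<^esub>"] \<theta>[OF _ e, of "\<one>\<^bsub>\<Gamma>\<^esub>"] by simp
  next
    case False
    then show ?thesis using \<pi> \<pi>' by (simp add: permutes_not_in)
  qed
qed

section \<open>The family of subgroups\<close>

definition family :: "(nat \<Rightarrow> nat) \<Rightarrow> (nat \<times> int) list set set" where
  "family \<pi> = perm_action.stab n p T (K \<pi>) x0"

lemma family_in:
  assumes \<pi>: "\<pi> permutes {1..M}" and d: "card X \<le> d"
  shows "family \<pi> \<in> free_subgroups T \<Gamma> d"
proof -
  interpret act: perm_action n p T "K \<pi>" by (rule perm_action_K[OF \<pi>])
  note trans = K_transitive[OF \<pi>] and kX = K_image[OF \<pi>]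
  have aut: "\<exists>g\<in>carrier \<Gamma>. f x0 = translate g x0"
    if f: "\<And>x. x \<in> X \<Longrightarrow> f x \<in> X \<and> (\<forall>i<n. f (K \<pi> i x) = K \<pi> i (f x))" for f
  proof -
    obtain \<theta> where \<theta>: "\<And>g z. g \<in> carrier \<Gamma> \<Longrightarrow> z \<in> Z \<Longrightarrow> \<theta> g \<in> carrier \<Gamma> \<and> f (z, g) = (z, \<theta> g)"
      using equivariant_sheets[OF \<pi> \<pi> f] by blast
    have "\<theta> \<one>\<^bsub>\<Gamma>\<^esub> \<in> carrier \<Gamma> \<and> f x0 = (z0, \<theta> \<one>\<^bsub>\<Gamma>\<^esub>)"
      using \<theta>[of "\<one>\<^bsub>\<Gamma>\<^esub>" z0] x0_in by (simp add: X_def)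
    then show ?thesis by (auto simp: translate_def)
  qed
  have "(T\<lparr>carrier := normalizer T (act.stab x0)\<rparr>) Mod act.stab x0 \<cong> \<Gamma>"
  proof (rule act.normalizer_quotient_iso[where R = translate and X = X])
    show "translate g (translate h x0) = translate (h \<otimes>\<^bsub>\<Gamma>\<^esub> g) x0" if "g \<in> carrier \<Gamma>" "h \<in> carrier \<Gamma>" for g h
      using that by (simp add: translate_def)
    show "translate g (K \<pi> i x) = K \<pi> i (translate g x)" if "g \<in> carrier \<Gamma>" "x \<in> X" for g x i
      using translate_K[OF \<pi> that] .
  qed (use kX x0_in trans translate_in aut Q.is_group in \<open>auto simp: translate_def\<close>)
  moreover have "free_group (T\<lparr>carrier := act.stab x0\<rparr>)"
    by (rule act.free_stab[OF finite_X x0_in kX trans K_free[OF \<pi>]])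
  moreover have "finite (rcosets\<^bsub>T\<^esub> act.stab x0)" "card (rcosets\<^bsub>T\<^esub> act.stab x0) \<le> card X"
    using act.rcosets_stab[OF finite_X kX x0_in trans] by blast+
  ultimately show ?thesis
    using act.subgroup_stab d by (simp add: free_subgroups_def family_def)
qed

text \<open>A conjugate stabiliser is the stabiliser of a moved point, so conjugacy yields an
  equivariant map between the two actions, and \<open>equivariant_eq\<close> applies.\<close>

lemma family_conjugate:
  assumes \<pi>: "\<pi> permutes {1..M}" and \<pi>': "\<pi>' permutes {1..M}" and g: "g \<in> carrier T"
    and conj: "family \<pi>' = g <#\<^bsub>T\<^esub> family \<pi> #>\<^bsub>T\<^esub> inv\<^bsub>T\<^esub> g"
  shows "\<pi> = \<pi>'"
proof -
  interpret act: perm_action n p T "K \<pi>" by (rule perm_action_K[OF \<pi>])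
  interpret act': perm_action n p T "K \<pi>'" by (rule perm_action_K[OF \<pi>'])
  have "act'.stab x0 = act.stab (act.act g x0)"
    using conj act.stab_act[OF g] by (simp add: family_def)
  from act'.equivariant_map[OF act.perm_action_axioms K_image[OF \<pi>'] K_transitive[OF \<pi>'] K_image[OF \<pi>]
      act.act_in[OF K_image[OF \<pi>] g x0_in] this]
  obtain f where "\<forall>x\<in>X. f x \<in> X \<and> (\<forall>i<n. f (K \<pi>' i x) = K \<pi> i (f x))" by blast
  then have "\<pi>' = \<pi>" by (intro equivariant_eq[OF \<pi>' \<pi>, of f]) blast
  then show ?thesis ..
qed

lemma fact_le_card_classes:
  assumes d: "card X \<le> d"
  shows "fact M \<le> card (conjugacy_classes_of_subgroups T (free_subgroups T \<Gamma> d))"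
proof -
  define cl where "cl = (\<lambda>H. orbit T (\<lambda>g H. g <#\<^bsub>T\<^esub> H #>\<^bsub>T\<^esub> inv\<^bsub>T\<^esub> g) H)"
  have classes: "conjugacy_classes_of_subgroups T \<H> = cl ` \<H>" for \<H>
    by (auto simp: conjugacy_classes_of_subgroups_def orbits_def cl_def)
  let ?P = "{\<pi>. \<pi> permutes {1..M}}"
  have inj: "inj_on (cl \<circ> family) ?P"
  proof (rule inj_onI)
    fix \<pi> \<pi>' assume \<pi>: "\<pi> \<in> ?P" "\<pi>' \<in> ?P" and eq: "(cl \<circ> family) \<pi> = (cl \<circ> family) \<pi>'"
    have "family \<pi>' \<subseteq> carrier T"
      using family_in[of \<pi>' d] \<pi> d by (auto simp: free_subgroups_def dest: subgroup.subset)
    then have "family \<pi>' = \<one>\<^bsub>T\<^esub> <#\<^bsub>T\<^esub> family \<pi>' #>\<^bsub>T\<^esub> inv\<^bsub>T\<^esub> \<one>\<^bsub>T\<^esub>"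
      using lcos_mult_one by simp
    then have "family \<pi>' \<in> cl (family \<pi>')" unfolding cl_def orbit_def using one_closed by blast
    then have "family \<pi>' \<in> cl (family \<pi>)" using eq by simp
    then obtain g where "g \<in> carrier T" "family \<pi>' = g <#\<^bsub>T\<^esub> family \<pi> #>\<^bsub>T\<^esub> inv\<^bsub>T\<^esub> g"
      by (auto simp: cl_def orbit_def)
    then show "\<pi> = \<pi>'" using family_conjugate \<pi> by blast
  qed
  \<comment> \<open>Finiteness of the target is essential: an injection into an infinite set bounds
    nothing, as \<open>card\<close> is 0 there.\<close>
  have "finite (free_subgroups T \<Gamma> d)"
    by (rule finite_subset[OF _ finite_subgroups_bounded_index[of d]]) (auto simp: free_subgroups_def)
  then have "finite (cl ` free_subgroups T \<Gamma> d)" by simp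
  moreover have "(cl \<circ> family) ` ?P \<subseteq> cl ` free_subgroups T \<Gamma> d"
    using family_in d by auto
  ultimately have "card ?P \<le> card (cl ` free_subgroups T \<Gamma> d)"
    using card_inj_on_le[OF inj] by blast
  then show ?thesis using card_permutations[of "{1..M}" M] by (simp add: classes)
qed

end

section \<open>Growth\<close>

text \<open>Each of the top \<open>m\<close> factors of the factorial is at least
  \<open>k\<close>.\<close>

lemma power_le_fact: "k ^ m \<le> fact (k + m)" for k m :: nat
proof (induction m)
  case (Suc m)
  have "k * k ^ m \<le> Suc (k + m) * fact (k + m)" using Suc by (intro mult_le_mono) simp_all
  then show ?case by (simp only: power_Suc add_Suc_right fact_Suc of_nat_id)
qed simp

text \<open>In the application \<open>D\<close> is the number of points per copy. The upper half of
  the factors of the factorial gives at least \<open>k ^ k\<close> with \<open>k\<close> about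
  \<open>d / (2 * D)\<close>.\<close>

lemma fact_div_growth:
  fixes D d :: nat
  assumes D: "1 \<le> D" and d: "16 * D * D + 8 * D \<le> d"
  shows "exp (1 / (8 * real D) * real d * ln (real d)) \<le> fact (d div D - 1)"
proof -
  define M where "M = d div D - 1"
  define k where "k = M div 2"
  \<comment> \<open>Taking half of the approximate size of \<open>k\<close> absorbs the roundings
    once \<open>d / D\<close> is at least 8.\<close>
  define x where "x = real d / (4 * real D)"
  have Dpos: "0 < real D" using D by simp
  have "real (16 * D * D + 8 * D) \<le> real d" using d of_nat_mono by blast
  then have dr: "16 * real D * real D + 8 * real D \<le> real d" by simp
  have "real d < real D * (real (d div D) + 1)"
  proof -
    have "d < D * (d div D + 1)" using dividend_less_times_div[of D d] D by simp
    then have "real d < real (D * (d div D + 1))" by (simp only: of_nat_less_iff)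
    then show ?thesis by (simp add: algebra_simps)
  qed
  then have div: "real d / real D < real (d div D) + 1" using Dpos by (simp add: field_simps)
  have k: "real (d div D) \<le> 2 * real k + 2"
    unfolding k_def M_def by linarith
  have "real d / real D \<ge> 8"
  proof -
    have "8 * real D \<le> real d" using dr Dpos by (smt (verit) mult_nonneg_nonneg)
    then show ?thesis using Dpos by (simp add: field_simps)
  qed
  then have xk: "x \<le> real k" using div k by (simp add: x_def)
  have x1: "1 \<le> x" using \<open>real d / real D \<ge> 8\<close> by (simp add: x_def)
  have "real d = x * (4 * real D)" using Dpos by (simp add: x_def)
  \<comment> \<open>This uses the summand \<open>16 * D * D\<close> of the bound. Then
    \<open>d = x * (4 * D)\<close> is at most \<open>x ^ 2\<close>, so \<open>ln d\<close> is at
    most \<open>2 * ln x\<close>, which accounts for the 8 in the exponent.\<close>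
  moreover have "4 * real D \<le> x"
  proof -
    have "4 * real D * (4 * real D) \<le> real d" using dr Dpos by simp
    then show ?thesis using Dpos by (simp add: x_def field_simps)
  qed
  ultimately have "real d \<le> x ^ 2" using x1 by (simp add: power2_eq_square)
  moreover have "0 < real d" using dr Dpos by (smt (verit) mult_nonneg_nonneg)
  ultimately have "ln (real d) \<le> ln (x ^ 2)" by (intro ln_mono) simp_all
  also have "\<dots> = 2 * ln x" using x1 by (simp add: ln_realpow)
  finally have "1 / (8 * real D) * real d * ln (real d) \<le> x * ln x"
    using Dpos x1 mult_left_mono[of "ln (real d)" "2 * ln x" "x / 2"] by (simp add: x_def field_simps)
  also have "\<dots> \<le> real k * ln (real k)" using xk x1 by (intro mult_mono) auto
  finally have "exp (1 / (8 * real D) * real d * ln (real d)) \<le> exp (real k * ln (real k))" by simp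
  also have "\<dots> = real k ^ k" using xk x1 by (simp add: exp_of_nat_mult)
  also have "\<dots> \<le> real (fact (k + k))" using power_le_fact[of k k] of_nat_mono by fastforce
  also have "\<dots> \<le> fact M" unfolding k_def by (simp add: fact_mono)
  finally show ?thesis by (simp add: M_def)
qed

section \<open>Rows for the two kinds of free product\<close>

definition row_system ::
  "nat \<Rightarrow> (nat \<Rightarrow> enat) \<Rightarrow> nat \<Rightarrow> 'a set \<Rightarrow> (nat \<Rightarrow> 'a \<Rightarrow> 'a) \<Rightarrow> 'a \<Rightarrow> nat list \<Rightarrow> bool" where
  "row_system n p l A s a0 rs \<longleftrightarrow> l < n \<and> finite A \<and> a0 \<in> A \<and>
    (\<forall>i<n. i \<noteq> l \<longrightarrow> s i permutes A \<and>
      (\<forall>m. p i = enat m \<longrightarrow> s i ^^ m = id \<and> (\<forall>a\<in>A. \<forall>j. 0 < j \<and> j < m \<longrightarrow> (s i ^^ j) a \<noteq> a))) \<and>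
    (\<forall>a\<in>A. \<forall>b\<in>A. \<exists>is\<in>lists ({..<n} - {l}). foldr s is a = b) \<and>
    rs \<in> lists ({..<n} - {l}) \<and> (\<forall>a\<in>A. foldr s rs a \<noteq> a) \<and> foldr s rs (foldr s rs a0) \<noteq> a0"

text \<open>The rows form a product of cyclic groups, one for each generator other than
  \<open>l\<close>, and every generator adds one in its own coordinate. The rotation is
  \<open>i1\<close> itself, whose cycles have length at least 3.\<close>

lemma row_system_product:
  assumes p: "\<And>i. i < n \<Longrightarrow> 2 \<le> p i" and l: "l < n" and i1: "i1 < n" "i1 \<noteq> l" "p i1 \<noteq> 2"
  shows "\<exists>(A :: (nat \<Rightarrow> nat) set) s a0 rs. row_system n p l A s a0 rs"
proof -
  \<comment> \<open>An infinite generator gets cycles of length 3, so that \<open>P i1\<close> is at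
    least 3 in every case.\<close>
  define P where "P = (\<lambda>i. case p i of enat m \<Rightarrow> m | \<infinity> \<Rightarrow> 3)"
  have P2: "2 \<le> P i" if "i < n" for i
    using p[OF that] by (auto simp: P_def numeral_eq_enat split: enat.split)
  have P3: "3 \<le> P i1"
    using p[OF i1(1)] i1(3) by (auto simp: P_def numeral_eq_enat split: enat.split)
  define I where "I = {..<n} - {l}"
  define A where "A = PiE I (\<lambda>i. {..<P i})"
  define s where "s = (\<lambda>i f. if f \<in> A then f(i := Suc (f i) mod P i) else f)"
  define a0 where "a0 = (\<lambda>i\<in>I. 0 :: nat)"
  have finA: "finite A" unfolding A_def I_def by (intro finite_PiE) auto
  have a0: "a0 \<in> A" using P2 by (force simp: A_def a0_def I_def)
  have upd: "f(i := b) \<in> A" if "f \<in> A" "i \<in> I" "b < P i" for f i b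
    using that by (auto simp: A_def PiE_iff extensional_def)
  have lt: "f i < P i" if "f \<in> A" "i \<in> I" for f i using that by (auto simp: A_def)
  have pow: "(s i ^^ m) f = f(i := (f i + m) mod P i)" if "i \<in> I" "f \<in> A" for i f m
  proof (induction m)
    case 0
    then show ?case using lt[OF that(2,1)] by simp
  next
    case (Suc m)
    have "f(i := (f i + m) mod P i) \<in> A" using upd that P2 by (force simp: I_def)
    then have "s i (f(i := (f i + m) mod P i)) = f(i := Suc ((f i + m) mod P i) mod P i)"
      by (simp add: s_def)
    then have "s i ((s i ^^ m) f) = f(i := Suc ((f i + m) mod P i) mod P i)" unfolding Suc.IH .
    then show ?case by (simp only: funpow.simps o_apply mod_Suc_eq add_Suc_right)
  qed
  have s_pow: "s i ^^ P i = id" if "i \<in> I" for i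
  proof
    fix f
    have "(s i ^^ m) f = f" if "f \<notin> A" for m using that by (induction m) (auto simp: s_def)
    then show "(s i ^^ P i) f = id f" using pow[OF that, of f "P i"] lt[OF _ that] by (cases "f \<in> A") auto
  qed
  have s_perm: "s i permutes A" if "i \<in> I" for i
    by (rule permutes_if_funpow_id[OF s_pow[OF that]]) (use P2[of i] that in \<open>auto simp: I_def s_def\<close>)
  have s_free: "(s i ^^ j) f \<noteq> f" if "i \<in> I" "f \<in> A" "0 < j" "j < P i" for i f j
  proof
    assume "(s i ^^ j) f = f"
    then have "(f i + j) mod P i = f i" using pow[OF that(1,2)] by (metis fun_upd_same)
    then show False using lt[OF that(2,1)] that(3,4) by (auto simp: mod_if split: if_splits)
  qed
  have trans: "\<exists>is\<in>lists I. foldr s is f = g" if f: "f \<in> A" and g: "g \<in> A" for f g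
  proof -
    have "finite I" by (simp add: I_def)
    \<comment> \<open>The coordinates are corrected one after another, each by a power of its own
      generator.\<close>
    have "\<exists>is\<in>lists I. foldr s is f = override_on f g J" if "J \<subseteq> I" for J
      using finite_subset[OF that \<open>finite I\<close>] that
    proof (induction J)
      case empty
      show ?case by (rule bexI[of _ "[]"]) auto
    next
      case (insert i J)
      then obtain "is" where "is": "is \<in> lists I" "foldr s is f = override_on f g J" by auto
      let ?h = "override_on f g J"
      have i: "i \<in> I" using insert by simp
      have h: "?h \<in> A"
        using f g insert.prems by (auto simp: A_def PiE_iff override_on_def extensional_def)
      define m where "m = P i - f i + g i"
      have "foldr s (replicate m i @ is) f = (s i ^^ m) ?h"
        using "is"(2) by (induction m) auto
      also have "\<dots> = ?h(i := (f i + m) mod P i)"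
        using pow[OF i h] insert.hyps by simp
      also have "f i + m = P i + g i" using lt[OF f i] by (simp add: m_def)
      also have "?h(i := (P i + g i) mod P i) = override_on f g (insert i J)"
        using lt[OF g i] by (simp add: override_on_insert)
      finally show ?case using "is"(1) i by (intro bexI[of _ "replicate m i @ is"]) auto
    qed
    then obtain "is" where "is \<in> lists I" "foldr s is f = override_on f g I" by blast
    moreover have "override_on f g I = g"
      using f g by (auto simp: A_def PiE_iff extensional_def override_on_def fun_eq_iff)
    ultimately show ?thesis by auto
  qed
  have I1: "i1 \<in> I" using i1 by (simp add: I_def)
  have "row_system n p l A s a0 [i1]"
    unfolding row_system_def I_def[symmetric]
  proof (intro conjI allI ballI impI)
    fix i assume "i < n" "i \<noteq> l"
    then have i: "i \<in> I" by (simp add: I_def)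
    show "s i permutes A" by (rule s_perm[OF i])
    fix m assume m: "p i = enat m"
    then have "P i = m" by (simp add: P_def)
    then show "s i ^^ m = id" using s_pow[OF i] by simp
    fix f j assume "f \<in> A" "0 < j \<and> j < m"
    then show "(s i ^^ j) f \<noteq> f" using s_free[OF i] \<open>P i = m\<close> by simp
  next
    fix f assume "f \<in> A"
    then show "foldr s [i1] f \<noteq> f" using s_free[OF I1, of f 1] P3 by simp
  next
    have "(s i1 ^^ 2) a0 \<noteq> a0" using s_free[OF I1 a0, of 2] P3 by simp
    then show "foldr s [i1] (foldr s [i1] a0) \<noteq> a0" by (simp add: numeral_2_eq_2)
  qed (use l finA a0 trans I1 in auto)
  then show ?thesis by blast
qed

text \<open>The rows are the corners of a hexagon; the two reflections are its two perfect matchings.\<close>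

lemma row_system_dihedral:
  assumes p: "\<And>i. i < n \<Longrightarrow> p i = 2" and n: "3 \<le> n"
  shows "\<exists>(A :: nat set) s a0 rs. row_system n p 0 A s a0 rs"
proof -
  \<comment> \<open>Modulo 6, \<open>f\<close> exchanges \<open>2 * k\<close> with
    \<open>2 * k + 1\<close>, and \<open>g\<close> exchanges \<open>2 * k + 1\<close> with
    \<open>2 * k + 2\<close>.\<close>
  define f where "f = (\<lambda>a :: nat. if a < 6 then [1, 0, 3, 2, 5, 4] ! a else a)"
  define g where "g = (\<lambda>a :: nat. if a < 6 then [5, 2, 1, 4, 3, 0] ! a else a)"
  define s where "s = (\<lambda>i :: nat. if i = 1 then f else g)"
  have less6: "a < 6 \<longleftrightarrow> a \<in> {0, 1, 2, 3, 4, 5}" for a :: nat by auto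
  have "f (f a) = a" for a by (cases "a < 6") (auto simp: less6 f_def)
  moreover have "g (g a) = a" for a by (cases "a < 6") (auto simp: less6 g_def)
  ultimately have s2: "s i ^^ 2 = id" for i by (auto simp: s_def fun_eq_iff numeral_2_eq_2)
  have s_free: "s i a \<noteq> a" if "a < 6" for i a
    using that by (auto simp: less6 s_def f_def g_def)
  have step: "\<exists>i\<in>{1, 2}. s i a = Suc a mod 6" if "a < 6" for a
    using that by (auto simp: less6 s_def f_def g_def)
  have trans: "\<exists>is\<in>lists ({..<n} - {0}). foldr s is a = b" if "a < 6" "b < 6" for a b
  proof -
    have "\<exists>is\<in>lists ({..<n} - {0}). foldr s is a = (a + m) mod 6" for m
    proof (induction m)
      case 0
      show ?case using that by (intro bexI[of _ "[]"]) auto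
    next
      case (Suc m)
      then obtain "is" where "is": "is \<in> lists ({..<n} - {0})" "foldr s is a = (a + m) mod 6" by blast
      obtain i where i: "i \<in> {1, 2}" "s i ((a + m) mod 6) = Suc ((a + m) mod 6) mod 6"
        using step[of "(a + m) mod 6"] by auto
      then have "foldr s (i # is) a = (a + Suc m) mod 6" using "is" by (simp add: mod_Suc_eq)
      moreover have "i # is \<in> lists ({..<n} - {0})" using i "is" n by auto
      ultimately show ?case by blast
    qed
    from this[of "6 - a + b"] show ?thesis using that by simp
  qed
  \<comment> \<open>\<open>g\<close> after \<open>f\<close> moves even corners two steps forward and
    odd corners two steps back: two disjoint three-cycles without fixed corners.\<close>
  have rot: "foldr s [2, 1] a = g (f a)" for a by (simp add: s_def)
  have "row_system n p 0 {..<6} s 0 [2, 1]"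
    unfolding row_system_def
  proof (intro conjI allI ballI impI)
    fix i assume i: "i < n" "i \<noteq> 0"
    show "s i permutes {..<6}"
      by (rule permutes_if_funpow_id[OF s2]) (auto simp: s_def f_def g_def)
    fix m assume "p i = enat m"
    then have m: "m = 2" using p[OF i(1)] by (simp add: numeral_eq_enat)
    then show "s i ^^ m = id" using s2 by simp
    fix a j assume "a \<in> {..<6 :: nat}" "0 < j \<and> j < m"
    moreover from this have "j = 1" using m by simp
    ultimately show "(s i ^^ j) a \<noteq> a" using s_free by simp
  next
    fix a assume "a \<in> {..<6 :: nat}"
    then show "foldr s [2, 1] a \<noteq> a" unfolding rot by (auto simp: less6 f_def g_def)
  next
    show "foldr s [2, 1] (foldr s [2, 1] 0) \<noteq> 0" unfolding rot by (simp add: f_def g_def)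
  qed (use n trans in auto)
  then show ?thesis by blast
qed

section \<open>Choice of the parameters\<close>

lemma free_subgroup_growth:
  fixes \<Gamma> :: "'g monoid" and A :: "'a set"
  assumes T: "cyclic_free_product n p T" and \<Gamma>: "group \<Gamma>" "finite (carrier \<Gamma>)"
    and rows: "row_system n p l A s a0 rs"
  shows "\<exists>A B :: real. \<exists>M :: nat. A > 1 \<and> B > 0 \<and>
    (\<forall>d\<ge>M. real (card (conjugacy_classes_of_subgroups T (free_subgroups T \<Gamma> d)))
              \<ge> A powr (B * real d * ln (real d)))"
proof -
  interpret cyclic_free_product n p T by (rule T)
  interpret \<Gamma>: group \<Gamma> by (rule \<Gamma>)
  have l: "l < n" and finA: "finite A" and a0: "a0 \<in> A" using rows by (auto simp: row_system_def)
  \<comment> \<open>An infinite order leaves the cycle length free; 2 is the least value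
    allowed.\<close>
  define q where "q = (case p l of enat m \<Rightarrow> m | \<infinity> \<Rightarrow> 2)"
  have q: "2 \<le> q" using two_le[OF l] by (auto simp: q_def numeral_eq_enat split: enat.split)
  define c where "c = card (carrier \<Gamma>)"
  have c: "1 \<le> c" using \<Gamma>(2) \<Gamma>.one_closed by (auto simp: c_def Suc_le_eq card_gt_0_iff)
  \<comment> \<open>The number of points per copy. With copies \<open>0\<close> to \<open>M\<close>
    there are \<open>D * Suc M\<close> points, hence \<open>M = d div D - 1\<close> below.\<close>
  define D where "D = card A * q * c"
  have "1 \<le> card A" using finA a0 by (auto simp: Suc_le_eq card_gt_0_iff)
  then have D: "1 \<le> D" using q c by (simp add: D_def Suc_le_eq)
  have bound: "fact (d div D - 1) \<le> card (conjugacy_classes_of_subgroups T (free_subgroups T \<Gamma> d))"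
    if d: "D * (c + 1) \<le> d" for d
  proof -
    define M where "M = d div D - 1"
    have "c + 1 \<le> d div D" using d D by (simp add: less_eq_div_iff_mult_less_eq mult.commute)
    then have M': "c \<le> M" "1 \<le> M" "d div D = Suc M" using c by (auto simp: M_def)
    obtain e where e: "bij_betw e {0..<c} (carrier \<Gamma>)"
      using ex_bij_betw_nat_finite[OF \<Gamma>(2)] by (auto simp: c_def)
    \<comment> \<open>Copies \<open>1\<close> to \<open>c\<close> carry the elements of
      \<open>\<Gamma>\<close>, and copy 0 the unit. There are enough copies because
      \<open>D * (c + 1) \<le> d\<close> gives \<open>c \<le> M\<close>.\<close>
    define v where "v = (\<lambda>j. if j \<in> {1..c} then e (j - 1) else \<one>\<^bsub>\<Gamma>\<^esub>)"
    have v_in: "v j \<in> carrier \<Gamma>" for j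
      using e by (auto simp: v_def bij_betw_def)
    have v: "v ` {1..M} = carrier \<Gamma>"
    proof
      show "carrier \<Gamma> \<subseteq> v ` {1..M}"
      proof
        fix g assume "g \<in> carrier \<Gamma>"
        then have "g \<in> e ` {0..<c}" using e by (simp add: bij_betw_def)
        then obtain j where j: "j < c" "g = e j" by auto
        then show "g \<in> v ` {1..M}" using M'(1) by (intro image_eqI[of _ _ "Suc j"]) (auto simp: v_def)
      qed
    qed (use v_in in auto)
    interpret permutation_family n p T \<Gamma> l q A s a0 rs M v
    proof unfold_locales
      show "m = q" if "p l = enat m" for m using that by (simp add: q_def)
      show "v j = \<one>\<^bsub>\<Gamma>\<^esub>" if "j \<notin> {1..M}" for j using that M'(1) by (auto simp: v_def)
    qed (use rows q \<Gamma>(2) M'(2) v in \<open>auto simp: row_system_def\<close>)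
    have "card X = D * Suc M" by (simp add: card_X D_def c_def algebra_simps)
    also have "\<dots> = D * (d div D)" using M' by simp
    finally have "card X \<le> d" by (simp add: mult.commute)
    from fact_le_card_classes[OF this] show ?thesis by (simp add: M_def)
  qed
  define N where "N = 16 * D * D + 8 * D + D * (c + 1)"
  have "exp 1 powr (1 / (8 * real D) * real d * ln (real d))
      \<le> real (card (conjugacy_classes_of_subgroups T (free_subgroups T \<Gamma> d)))" if d: "N \<le> d" for d
  proof -
    have "exp 1 powr (1 / (8 * real D) * real d * ln (real d)) = exp (1 / (8 * real D) * real d * ln (real d))"
      by (simp add: powr_def)
    also have "\<dots> \<le> fact (d div D - 1)" using d D by (intro fact_div_growth) (simp_all add: N_def)
    also have "\<dots> = real (fact (d div D - 1))" by simp
    also have "\<dots> \<le> real (card (conjugacy_classes_of_subgroups T (free_subgroups T \<Gamma> d)))"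
      using bound[of d] d by (simp only: of_nat_le_iff) (simp add: N_def)
    finally show ?thesis .
  qed
  moreover have "(1 :: real) < exp 1" "0 < 1 / (8 * real D)" using D by simp_all
  ultimately show ?thesis by blast
qed

text \<open>This allows the orders to be replaced by the constant 2 although they are known only on
  the index set.\<close>

lemma free_product_cong:
  assumes "\<And>i. i \<in> I \<Longrightarrow> G i = G' i"
  shows "free_product I G = free_product I G'"
proof -
  have words: "fp_words I G = fp_words I G'" unfolding fp_words_def using assms by (metis SigmaE Sigma_cong)
  have sub: "fp_rel I G \<subseteq> fp_rel I G'" if "\<And>i. i \<in> I \<Longrightarrow> G i = G' i" "fp_words I G = fp_words I G'" for G G' :: "_ \<Rightarrow> ('b, 'c) monoid_scheme"
  proof (rule subrelI)
    fix u w assume "(u, w) \<in> fp_rel I G"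
    then show "(u, w) \<in> fp_rel I G'"
    proof induction
      case (one u v i)
      then show ?case using fp_rel.one[of u I G' v i] that by simp
    next
      case (mult u v i x y)
      then show ?case using fp_rel.mult[of u I G' v i x y] that by simp
    qed (use that in \<open>auto intro: fp_rel.refl fp_rel.sym fp_rel.trans\<close>)
  qed
  have "fp_rel I G = fp_rel I G'" using sub[of G G'] sub[of G' G] assms words by auto
  then show ?thesis using words by (simp add: free_product_def)
qed

theorem theorem6p1:
  fixes n :: nat and p :: "nat \<Rightarrow> enat"
    and T :: "(nat \<times> int) list set monoid" and \<Gamma> :: "'g monoid"
  assumes "n \<ge> 2"
    and "\<And>i. i < n \<Longrightarrow> p i \<ge> 2"
    and "T = free_product {..<n} (\<lambda>i. cyclic_group_of_order (p i))"
    and "\<not> T \<cong> free_product {..<2::nat} (\<lambda>_. cyclic_group_of_order 2)"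
    and "group \<Gamma>" and "finite (carrier \<Gamma>)"
  shows "\<exists>A B :: real. \<exists>M :: nat. A > 1 \<and> B > 0 \<and>
    (\<forall>d\<ge>M. real (card (conjugacy_classes_of_subgroups T (free_subgroups T \<Gamma> d)))
              \<ge> A powr (B * real d * ln (real d)))"
proof -
  have T: "cyclic_free_product n p T" using assms(2,3) by unfold_locales auto
  show ?thesis
  proof (cases "\<exists>i<n. p i \<noteq> 2")
    case True
    then obtain i where i: "i < n" "p i \<noteq> 2" by blast
    \<comment> \<open>The generator of order other than 2 has to act on the rows, so a different
      index becomes the last generator.\<close>
    define l where "l = (if i = 0 then 1 else 0 :: nat)"
    have "l < n" "i \<noteq> l" using assms(1) by (auto simp: l_def)
    with assms(2) i have "\<exists>(A :: (nat \<Rightarrow> nat) set) s a0 rs. row_system n p l A s a0 rs"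
      by (intro row_system_product[of n p l i]) auto
    then show ?thesis by (elim exE) (rule free_subgroup_growth[OF T assms(5,6)])
  next
    case False
    \<comment> \<open>Two factors of order 2 give the excluded group. With at least three, two
      reflections remain for the rows besides the last generator.\<close>
    have "n \<noteq> 2"
    proof
      assume "n = 2"
      then have "T = free_product {..<2::nat} (\<lambda>_. cyclic_group_of_order 2)"
        unfolding assms(3) \<open>n = 2\<close> using False \<open>n = 2\<close> by (intro free_product_cong) auto
      then show False using assms(4) iso_refl by metis
    qed
    then have "3 \<le> n" using assms(1) by simp
    with False have "\<exists>(A :: nat set) s a0 rs. row_system n p 0 A s a0 rs"
      by (intro row_system_dihedral) auto
    then show ?thesis by (elim exE) (rule free_subgroup_growth[OF T assms(5,6)])
  qed
qed

end
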